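(* Let $q=2$. Suppose that the abstract decomposition framework described in the context holds (Assumptions (I), (II), (III)), with $\mathcal{A}_\ell$ being $k_\ell$-monotone for $k_\ell\colon\mathcal{V}_\ell\to[0,\infty)$, $\ell=1,2$. Let $u\in\mathcal{W}$ be the solution of $\mathcal{F}u=0$ in $\mathcal{V}^*$ and assume that $u\in D(\mathcal{F}_1)\cap D(\mathcal{F}_2)$. Let $s>0$ be arbitrary, let $u_2^0\in D(\mathcal{F}_2)$, and let $(u_1^{n+1},u_2^{n+1})\in D(\mathcal{F}_1)\times D(\mathcal{F}_2)$, $n=0,1,2,\ldots$, be generated either by the Peaceman--Rachford scheme $$(sI+\mathcal{F}_1)u_1^{n+1}=(sI-\mathcal{F}_2)u_2^{n},\qquad (sI+\mathcal{F}_2)u_2^{n+1}=(sI-\mathcal{F}_1)u_1^{n+1},$$ or by the Douglas--Rachford scheme $$(sI+\mathcal{F}_1)u_1^{n+1}=(sI-\mathcal{F}_2)u_2^{n},\qquad (sI+\mathcal{F}_2)u_2^{n+1}=su_1^{n+1}+\mathcal{F}_2u_2^{n}.$$ Then $$\lim_{n\to\infty}\Bigl(k_1\bigl(\mathcal{R}_1(u_1^n-u)\bigr)+k_2\bigl(\mathcal{R}_2(u_2^n-u)\bigr)\Bigr)=0.$$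
   Context: **Operator notions.** Let $V$ be a real Banach space with dual $V^*$ and dual pairing $\langle\cdot,\cdot\rangle_{V^*\times V}$, and $G\colon V\to V^*$ possibly nonlinear. $G$ is bounded if it maps bounded sets to bounded sets; for a function $k\colon V\to[0,\infty)$, $G$ is $k$-monotone if $\langle Gu-Gv,u-v\rangle_{V^*\times V}\ge k(u-v)$ for all $u,v\in V$ (monotone if this holds with $k\equiv0$); $G$ is hemicontinuous if $\varepsilon\mapsto\langle G(u+\varepsilon v),w\rangle_{V^*\times V}$ is continuous on $[0,1]$ for all $u,v,w\in V$; $G$ is coercive if $\langle Gu,u\rangle_{V^*\times V}\to\infty$ as $\|u\|_V\to\infty$; $G$ is symmetric if $\langle Gu,v\rangle=\langle Gv,u\rangle$ for all $u,v$. For $M\colon H\to H$ on a Hilbert space the same terms are used with the inner product of $H$. **Spaces.** Fix $T>0$ and $p\in[2,\infty)$. If $V$ is a separable, reflexive Banach space densely (and continuously) embedded in a Hilbert space $H$, put $\mathcal{H}=L^2(0,T;H)$, $\mathcal{V}=L^p(0,T;V)$, $\mathcal{V}^*\cong L^{p/(p-1)}(0,T;V^* )$, with Gelfand triples $V\hookrightarrow H\hookrightarrow V^*$ and $\mathcal{V}\hookrightarrow\mathcal{H}\hookrightarrow\mathcal{V}^*$. A bounded linear $M\colon H\to H$ induces $(\mathcal{M}u)(t)=Mu(t)$ on $\mathcal{H}$, and a family $A(t)\colon V\to V^*$ induces $\mathcal{A}\colon\mathcal{V}\to\mathcal{V}^*$, $(\mathcal{A}u)(t)=A(t)u(t)$,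 for a.e. $t\in(0,T)$. The operator $\mathrm{d}/\mathrm{d}t$ on $\mathcal{V}^*$ has domain $D(\mathrm{d}/\mathrm{d}t)=\{u\in W^{1,p/(p-1)}(0,T;V^* ):u(0)=0\}$; equivalently $\mathrm{d}/\mathrm{d}t\,u=\lim_{\tau\to0^+}\frac1\tau(I-S(\tau))u$ in $\mathcal{V}^*$, where $S(\tau)u(t)=0$ for $0\le t\le\tau$ and $S(\tau)u(t)=u(t-\tau)$ for $\tau<t\le T$. Put $\mathcal{W}=\{u\in\mathcal{V}:\mathcal{M}u\in D(\mathrm{d}/\mathrm{d}t)\}$. **Proper.** $(V,H,M,\mathcal{A})$ is proper if $V$ is a separable, reflexive Banach space densely embedded in the Hilbert space $H$; $M\colon H\to H$ is linear, bounded, monotone and symmetric; and $\mathcal{A}\colon\mathcal{V}\to\mathcal{V}^*$ is bounded, $k$-monotone (for some $k\colon\mathcal{V}\to[0,\infty)$), hemicontinuous and coercive. **Decomposition.** We are given $(V,H,M,\mathcal{A})$ and $(V_\ell,H_\ell,M_\ell,\mathcal{A}_\ell)$, $\ell=1,\ldots,q$ (all with the same $p$ and $T$; the induced objects are $\mathcal{H}_\ell=L^2(0,T;H_\ell)$, $\mathcal{V}_\ell=L^p(0,T;V_\ell)$ with $\mathcal{V}_\ell^*\cong L^{p/(p-1)}(0,T;V_\ell^* )$, $(\mathcal{M}_\ell u)(t)=M_\ell u(t)$ for $u\in\mathcal{H}_\ell$ and a.e. $t\in(0,T)$, the operator $\mathrm{d}/\mathrm{d}t$ on $\mathcal{V}_\ell^*$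 with domain $\{u\in W^{1,p/(p-1)}(0,T;V_\ell^* ):u(0)=0\}$, and $\mathcal{W}_\ell=\{u\in\mathcal{V}_\ell:\mathcal{M}_\ell u\in W^{1,p/(p-1)}(0,T;V_\ell^* ),\ (\mathcal{M}_\ell u)(0)=0\}$), linear bounded operators $E_\ell\colon H_\ell\to H$, $R_\ell\colon H\to H_\ell$, with induced operators $(\mathcal{E}_\ell u)(t)=E_\ell u(t)$, $(\mathcal{R}_\ell u)(t)=R_\ell u(t)$, and functionals $f\in\mathcal{V}^*$, $f_\ell\in\mathcal{V}_\ell^*$. Define $\mathcal{F}u=\mathrm{d}/\mathrm{d}t\,\mathcal{M}u+\mathcal{A}u+f\in\mathcal{V}^*$ for $u\in\mathcal{W}$, and $$D(\mathcal{F}_\ell)=\{u\in\mathcal{H}:\mathcal{R}_\ell u\in\mathcal{W}_\ell,\ (\mathrm{d}/\mathrm{d}t\,\mathcal{M}_\ell+\mathcal{A}_\ell)\mathcal{R}_\ell u+f_\ell\in\mathcal{H}_\ell\},$$ $$\mathcal{F}_\ell u=\mathcal{E}_\ell\bigl((\mathrm{d}/\mathrm{d}t\,\mathcal{M}_\ell+\mathcal{A}_\ell)\mathcal{R}_\ell u+f_\ell\bigr)\in\mathcal{H},\quad u\in D(\mathcal{F}_\ell).$$ **Assumption (I).** All the problem sets are proper; $R_\ell E_\ell=I$ on $H_\ell$ and $(E_\ell u,v)_H=(u,R_\ell v)_{H_\ell}$ for all $u\in H_\ell$, $v\in H$; $Mu=\sum_{\ell=1}^qE_\ell M_\ell R_\ell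 u$ for all $u\in H$. **Assumption (II).** Each $R_\ell$ is bounded from $V$ to $V_\ell$; and if $u\in H$ satisfies $R_\ell u\in V_\ell$ for all $\ell$, then $u\in V$ and $\|u\|_V^p\le C\sum_{\ell=1}^q\|R_\ell u\|_{V_\ell}^p$ with a constant $C>0$ independent of $u$. **Assumption (III).** For every $u\in\bigcap_{\ell=1}^qD(\mathcal{F}_\ell)$ (such $u$ lie in $\mathcal{W}$ by (I) and (II)) one has $\mathcal{F}u=\sum_{\ell=1}^q\mathcal{F}_\ell u$ in $\mathcal{H}$. Under Assumption (I), for every $s>0$ the operator $sI+\mathcal{F}_\ell\colon D(\mathcal{F}_\ell)\to\mathcal{H}$ is bijective, so the schemes are well defined. *)

theory Defs
  imports "HOL-Analysis.Analysis"
begin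

section \<open>Bochner--Lebesgue spaces on a time interval\<close>

text \<open>
  Elements of \<open>L\<^sup>p(0,T;X)\<close> are represented by functions \<open>real \<Rightarrow> X\<close>, of which only the values on
  \<open>[0,T]\<close> up to null sets matter; equality in these spaces is \<open>aeq T\<close>.
  Measurability is strong (Bochner) measurability. The measure is the
  completed one, so that almost everywhere limits of simple functions are again measurable. No
  second countability of the type \<open>X\<close> is needed, which is what allows \<open>X = V\<^sup>*\<close> below.
\<close>

abbreviation time_measure :: "real \<Rightarrow> real measure"
  where "time_measure T \<equiv> lebesgue_on {0..T}"

definition aeq :: "real \<Rightarrow> (real \<Rightarrow> 'a) \<Rightarrow> (real \<Rightarrow> 'a) \<Rightarrow> bool"
  where "aeq T f g \<longleftrightarrow> (AE t in time_measure T. f t = g t)"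

definition strongly_measurable :: "real \<Rightarrow> (real \<Rightarrow> 'a::real_normed_vector) \<Rightarrow> bool"
  where "strongly_measurable T f \<longleftrightarrow>
    (\<exists>s. (\<forall>n. simple_function (time_measure T) (s n)) \<and>
         (AE t in time_measure T. (\<lambda>n::nat. s n t) \<longlonglongrightarrow> f t))"

definition Lp :: "real \<Rightarrow> real \<Rightarrow> (real \<Rightarrow> 'a::real_normed_vector) set"
  where "Lp T p = {f. strongly_measurable T f \<and>
                      integrable (time_measure T) (\<lambda>t. norm (f t) powr p)}"

definition Lp_norm :: "real \<Rightarrow> real \<Rightarrow> (real \<Rightarrow> 'a::real_normed_vector) \<Rightarrow> real"
  where "Lp_norm T p f = (\<integral>t. norm (f t) powr p \<partial>time_measure T) powr (1 / p)"

abbreviation conj_exponent :: "real \<Rightarrow> real"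
  where "conj_exponent p \<equiv> p / (p - 1)"

type_synonym 'v dual = "'v \<Rightarrow>\<^sub>L real"

text \<open>The pairing of \<open>L\<^bsup>p/(p-1)\<^esup>(0,T;V\<^sup>*) \<cong> L\<^sup>p(0,T;V)\<^sup>*\<close> with \<open>L\<^sup>p(0,T;V)\<close>.\<close>

definition pairing :: "real \<Rightarrow> (real \<Rightarrow> 'v::real_normed_vector dual) \<Rightarrow> (real \<Rightarrow> 'v) \<Rightarrow> real"
  where "pairing T g u = (\<integral>t. blinfun_apply (g t) (u t) \<partial>time_measure T)"


section \<open>The time derivative\<close>

text \<open>
  \<open>W\<^bsup>1,r\<^esup>(0,T;V\<^sup>*)\<close> is defined by weak derivatives against \<open>C\<^sup>1\<close> test functions with
  compact support in \<open>(0,T)\<close>. The identity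
  \<open>\<integral> \<phi>' w dt = - \<integral> \<phi> g dt\<close> in \<open>V\<^sup>*\<close> is stated by evaluating both Bochner integrals at every \<open>v \<in> V\<close>.
\<close>

definition test_function :: "real \<Rightarrow> (real \<Rightarrow> real) \<Rightarrow> (real \<Rightarrow> real) \<Rightarrow> bool"
  where "test_function T \<phi> \<phi>' \<longleftrightarrow>
    (\<forall>t. (\<phi> has_real_derivative \<phi>' t) (at t)) \<and> continuous_on UNIV \<phi>' \<and>
    (\<exists>a b. 0 < a \<and> a < b \<and> b < T \<and> (\<forall>t. t \<notin> {a..b} \<longrightarrow> \<phi> t = 0))"

definition weak_derivative ::
    "real \<Rightarrow> (real \<Rightarrow> 'v::real_normed_vector dual) \<Rightarrow> (real \<Rightarrow> 'v dual) \<Rightarrow> bool"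
  where "weak_derivative T w g \<longleftrightarrow>
    (\<forall>\<phi> \<phi>' v. test_function T \<phi> \<phi>' \<longrightarrow>
       (\<integral>t. \<phi>' t * blinfun_apply (w t) v \<partial>time_measure T) =
       - (\<integral>t. \<phi> t * blinfun_apply (g t) v \<partial>time_measure T))"

definition sobolev_W1 :: "real \<Rightarrow> real \<Rightarrow> (real \<Rightarrow> 'v::real_normed_vector dual) set"
  where "sobolev_W1 T r = {w \<in> Lp T r. \<exists>g \<in> Lp T r. weak_derivative T w g}"

text \<open>The initial value \<open>w(0)\<close> is that of the continuous representative \<open>c\<close> of \<open>w\<close>.\<close>

definition ddt_dom :: "real \<Rightarrow> real \<Rightarrow> (real \<Rightarrow> 'v::real_normed_vector dual) set"
  where "ddt_dom T r =
    {w \<in> sobolev_W1 T r. \<exists>c. continuous_on {0..T} c \<and> aeq T w c \<and> c 0 = 0}"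

text \<open>The choice is unique up to \<open>aeq T\<close>.\<close>

definition ddt :: "real \<Rightarrow> real \<Rightarrow> (real \<Rightarrow> 'v::real_normed_vector dual) \<Rightarrow> (real \<Rightarrow> 'v dual)"
  where "ddt T r w = (SOME g. g \<in> Lp T r \<and> weak_derivative T w g)"


section \<open>Nonlinear operators from \<open>L\<^sup>p(0,T;V)\<close> to its dual\<close>

text \<open>Maps on \<open>L\<^sup>p(0,T;V)\<close> are maps on representatives that respect almost everywhere equality.\<close>

definition Lp_operator ::
    "real \<Rightarrow> real \<Rightarrow> ((real \<Rightarrow> 'v::real_normed_vector) \<Rightarrow> (real \<Rightarrow> 'v dual)) \<Rightarrow> bool"
  where "Lp_operator T p A \<longleftrightarrow>
    (\<forall>u \<in> Lp T p. A u \<in> Lp T (conj_exponent p)) \<and>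
    (\<forall>u \<in> Lp T p. \<forall>v \<in> Lp T p. aeq T u v \<longrightarrow> aeq T (A u) (A v))"

definition nonneg_functional ::
    "real \<Rightarrow> real \<Rightarrow> ((real \<Rightarrow> 'v::real_normed_vector) \<Rightarrow> real) \<Rightarrow> bool"
  where "nonneg_functional T p k \<longleftrightarrow>
    (\<forall>u \<in> Lp T p. 0 \<le> k u) \<and>
    (\<forall>u \<in> Lp T p. \<forall>v \<in> Lp T p. aeq T u v \<longrightarrow> k u = k v)"

definition bounded_operator ::
    "real \<Rightarrow> real \<Rightarrow> ((real \<Rightarrow> 'v::real_normed_vector) \<Rightarrow> (real \<Rightarrow> 'v dual)) \<Rightarrow> bool"
  where "bounded_operator T p A \<longleftrightarrow>
    (\<forall>r. \<exists>C. \<forall>u \<in> Lp T p. Lp_norm T p u \<le> r \<longrightarrow> Lp_norm T (conj_exponent p) (A u) \<le> C)"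

definition k_monotone ::
    "real \<Rightarrow> real \<Rightarrow> ((real \<Rightarrow> 'v::real_normed_vector) \<Rightarrow> real) \<Rightarrow>
      ((real \<Rightarrow> 'v) \<Rightarrow> (real \<Rightarrow> 'v dual)) \<Rightarrow> bool"
  where "k_monotone T p k A \<longleftrightarrow>
    (\<forall>u \<in> Lp T p. \<forall>v \<in> Lp T p.
       pairing T (\<lambda>t. A u t - A v t) (\<lambda>t. u t - v t) \<ge> k (\<lambda>t. u t - v t))"

definition hemicontinuous ::
    "real \<Rightarrow> real \<Rightarrow> ((real \<Rightarrow> 'v::real_normed_vector) \<Rightarrow> (real \<Rightarrow> 'v dual)) \<Rightarrow> bool"
  where "hemicontinuous T p A \<longleftrightarrow>
    (\<forall>u \<in> Lp T p. \<forall>v \<in> Lp T p. \<forall>w \<in> Lp T p.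
       continuous_on {0..1} (\<lambda>\<epsilon>. pairing T (A (\<lambda>t. u t + \<epsilon> *\<^sub>R v t)) w))"

definition coercive ::
    "real \<Rightarrow> real \<Rightarrow> ((real \<Rightarrow> 'v::real_normed_vector) \<Rightarrow> (real \<Rightarrow> 'v dual)) \<Rightarrow> bool"
  where "coercive T p A \<longleftrightarrow>
    (\<forall>C. \<exists>r. \<forall>u \<in> Lp T p. Lp_norm T p u \<ge> r \<longrightarrow> pairing T (A u) u \<ge> C)"


section \<open>Proper problem sets\<close>

definition separable_space :: "'v::real_normed_vector itself \<Rightarrow> bool"
  where "separable_space _ \<longleftrightarrow> (\<exists>D::'v set. countable D \<and> closure D = UNIV)"

definition reflexive_space :: "'v::real_normed_vector itself \<Rightarrow> bool"
  where "reflexive_space _ \<longleftrightarrow>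
    (\<forall>\<Phi> :: 'v dual dual. \<exists>v. \<forall>f. blinfun_apply \<Phi> f = blinfun_apply f v)"

definition dense_embedding :: "'v::real_normed_vector \<Rightarrow>\<^sub>L 'h::real_normed_vector \<Rightarrow> bool"
  where "dense_embedding j \<longleftrightarrow>
    inj (blinfun_apply j) \<and> closure (range (blinfun_apply j)) = UNIV"

text \<open>
  \<open>V\<close> and \<open>H\<close> are the types \<open>'v\<close> and \<open>'h\<close>, and the inclusion of \<open>V\<close> in \<open>H\<close> is the embedding
  \<open>emb\<close>. The operator \<open>evol\<close> acts on \<open>L\<^sup>p(0,T;V)\<close>.
\<close>

record (overloaded) ('v::real_normed_vector, 'h::real_normed_vector) problem =
  emb :: "'v \<Rightarrow>\<^sub>L 'h"
  mass :: "'h \<Rightarrow>\<^sub>L 'h"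
  evol :: "(real \<Rightarrow> 'v) \<Rightarrow> (real \<Rightarrow> 'v \<Rightarrow>\<^sub>L real)"
  source :: "real \<Rightarrow> 'v \<Rightarrow>\<^sub>L real"

definition proper :: "real \<Rightarrow> real \<Rightarrow> ('v::banach, 'h::{real_inner,banach}) problem \<Rightarrow> bool"
  where "proper T p P \<longleftrightarrow>
    separable_space TYPE('v) \<and> reflexive_space TYPE('v) \<and> dense_embedding (emb P) \<and>
    (\<forall>u v. inner (mass P u - mass P v) (u - v) \<ge> 0) \<and>
    (\<forall>u v. inner (mass P u) v = inner (mass P v) u) \<and>
    Lp_operator T p (evol P) \<and> bounded_operator T p (evol P) \<and>
    (\<exists>k. nonneg_functional T p k \<and> k_monotone T p k (evol P)) \<and>
    hemicontinuous T p (evol P) \<and> coercive T p (evol P)"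


section \<open>The Gelfand triple and the evolution operators\<close>

text \<open>The embedding of \<open>H\<close> in \<open>V\<^sup>*\<close> sends \<open>h\<close> to \<open>v \<mapsto> (h, v)\<^sub>H\<close>.\<close>

definition to_dual :: "'v::real_normed_vector \<Rightarrow>\<^sub>L 'h::real_inner \<Rightarrow> 'h \<Rightarrow> 'v dual"
  where "to_dual j h = blinfun_inner_right h o\<^sub>L j"

text \<open>
  For \<open>u\<close> in \<open>L\<^sup>2(0,T;H)\<close> that belongs to \<open>L\<^sup>p(0,T;V)\<close>, \<open>V_part\<close> is \<open>u\<close> regarded as an element of
  \<open>L\<^sup>p(0,T;V)\<close>; for \<open>g\<close> in \<open>L\<^bsup>p/(p-1)\<^esup>(0,T;V\<^sup>*)\<close> that belongs to \<open>L\<^sup>2(0,T;H)\<close>, \<open>H_part\<close> is \<open>g\<close>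
  regarded as an element of \<open>L\<^sup>2(0,T;H)\<close>. Since the embeddings are injective, both are unique up to
  \<open>aeq T\<close>.
\<close>

definition V_part ::
    "real \<Rightarrow> real \<Rightarrow> 'v::real_normed_vector \<Rightarrow>\<^sub>L 'h::real_normed_vector \<Rightarrow>
      (real \<Rightarrow> 'h) \<Rightarrow> (real \<Rightarrow> 'v)"
  where "V_part T p j u = (SOME x. x \<in> Lp T p \<and> aeq T (\<lambda>t. j (x t)) u)"

definition H_part ::
    "real \<Rightarrow> 'v::real_normed_vector \<Rightarrow>\<^sub>L 'h::real_inner \<Rightarrow> (real \<Rightarrow> 'v dual) \<Rightarrow> (real \<Rightarrow> 'h)"
  where "H_part T j g = (SOME h. h \<in> Lp T 2 \<and> aeq T (\<lambda>t. to_dual j (h t)) g)"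

definition mass_path ::
    "('v::real_normed_vector, 'h::real_inner) problem \<Rightarrow> (real \<Rightarrow> 'v) \<Rightarrow> (real \<Rightarrow> 'v dual)"
  where "mass_path P x = (\<lambda>t. to_dual (emb P) (mass P (emb P (x t))))"

definition W_space ::
    "real \<Rightarrow> real \<Rightarrow> ('v::real_normed_vector, 'h::real_inner) problem \<Rightarrow> (real \<Rightarrow> 'v) set"
  where "W_space T p P = {x \<in> Lp T p. mass_path P x \<in> ddt_dom T (conj_exponent p)}"

text \<open>\<open>d/dt M x + A x + f\<close>, as an element of \<open>L\<^bsup>p/(p-1)\<^esup>(0,T;V\<^sup>*)\<close> for \<open>x\<close> in \<open>W_space\<close>.\<close>

definition full_op ::
    "real \<Rightarrow> real \<Rightarrow> ('v::real_normed_vector, 'h::real_inner) problem \<Rightarrow>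
      (real \<Rightarrow> 'v) \<Rightarrow> (real \<Rightarrow> 'v dual)"
  where "full_op T p P x =
    (\<lambda>t. ddt T (conj_exponent p) (mass_path P x) t + evol P x t + source P t)"

text \<open>The split operators on \<open>L\<^sup>2(0,T;H)\<close> induced by a subproblem \<open>Q\<close> with transfer maps \<open>E\<close>, \<open>R\<close>.\<close>

definition split_dom ::
    "real \<Rightarrow> real \<Rightarrow> ('w::real_normed_vector, 'g::real_inner) problem \<Rightarrow>
      'h::real_normed_vector \<Rightarrow>\<^sub>L 'g \<Rightarrow> (real \<Rightarrow> 'h) set"
  where "split_dom T p Q R =
    {u \<in> Lp T 2. \<exists>x \<in> W_space T p Q. aeq T (\<lambda>t. emb Q (x t)) (\<lambda>t. R (u t)) \<and>
       (\<exists>h \<in> Lp T 2. aeq T (\<lambda>t. to_dual (emb Q) (h t)) (full_op T p Q x))}"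

definition split_op ::
    "real \<Rightarrow> real \<Rightarrow> ('w::real_normed_vector, 'g::real_inner) problem \<Rightarrow>
      'g \<Rightarrow>\<^sub>L 'h::real_normed_vector \<Rightarrow> 'h \<Rightarrow>\<^sub>L 'g \<Rightarrow> (real \<Rightarrow> 'h) \<Rightarrow> (real \<Rightarrow> 'h)"
  where "split_op T p Q E R u =
    (\<lambda>t. E (H_part T (emb Q) (full_op T p Q (V_part T p (emb Q) (\<lambda>t. R (u t)))) t))"


section \<open>The decomposition framework with two subproblems\<close>

definition decomposition_I ::
    "real \<Rightarrow> real \<Rightarrow> ('v::banach, 'h::{real_inner,banach}) problem \<Rightarrow>
      ('v1::banach, 'h1::{real_inner,banach}) problem \<Rightarrow> 'h1 \<Rightarrow>\<^sub>L 'h \<Rightarrow> 'h \<Rightarrow>\<^sub>L 'h1 \<Rightarrow>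
      ('v2::banach, 'h2::{real_inner,banach}) problem \<Rightarrow> 'h2 \<Rightarrow>\<^sub>L 'h \<Rightarrow> 'h \<Rightarrow>\<^sub>L 'h2 \<Rightarrow> bool"
  where "decomposition_I T p P P1 E1 R1 P2 E2 R2 \<longleftrightarrow>
    proper T p P \<and> proper T p P1 \<and> proper T p P2 \<and>
    (\<forall>u. R1 (E1 u) = u) \<and> (\<forall>u. R2 (E2 u) = u) \<and>
    (\<forall>u v. inner (E1 u) v = inner u (R1 v)) \<and> (\<forall>u v. inner (E2 u) v = inner u (R2 v)) \<and>
    (\<forall>u. mass P u = E1 (mass P1 (R1 u)) + E2 (mass P2 (R2 u)))"

definition decomposition_II ::
    "real \<Rightarrow> ('v::banach, 'h::{real_inner,banach}) problem \<Rightarrow>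
      ('v1::banach, 'h1::{real_inner,banach}) problem \<Rightarrow> 'h \<Rightarrow>\<^sub>L 'h1 \<Rightarrow>
      ('v2::banach, 'h2::{real_inner,banach}) problem \<Rightarrow> 'h \<Rightarrow>\<^sub>L 'h2 \<Rightarrow> bool"
  where "decomposition_II p P P1 R1 P2 R2 \<longleftrightarrow>
    (\<exists>S1 :: 'v \<Rightarrow>\<^sub>L 'v1. \<forall>v. emb P1 (S1 v) = R1 (emb P v)) \<and>
    (\<exists>S2 :: 'v \<Rightarrow>\<^sub>L 'v2. \<forall>v. emb P2 (S2 v) = R2 (emb P v)) \<and>
    (\<exists>C > 0. \<forall>u x1 x2. R1 u = emb P1 x1 \<and> R2 u = emb P2 x2 \<longrightarrow>
       (\<exists>v. u = emb P v \<and> norm v powr p \<le> C * (norm x1 powr p + norm x2 powr p)))"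

definition decomposition_III ::
    "real \<Rightarrow> real \<Rightarrow> ('v::banach, 'h::{real_inner,banach}) problem \<Rightarrow>
      ('v1::banach, 'h1::{real_inner,banach}) problem \<Rightarrow> 'h1 \<Rightarrow>\<^sub>L 'h \<Rightarrow> 'h \<Rightarrow>\<^sub>L 'h1 \<Rightarrow>
      ('v2::banach, 'h2::{real_inner,banach}) problem \<Rightarrow> 'h2 \<Rightarrow>\<^sub>L 'h \<Rightarrow> 'h \<Rightarrow>\<^sub>L 'h2 \<Rightarrow> bool"
  where "decomposition_III T p P P1 E1 R1 P2 E2 R2 \<longleftrightarrow>
    (\<forall>u \<in> split_dom T p P1 R1 \<inter> split_dom T p P2 R2.
     \<forall>x \<in> W_space T p P. aeq T (\<lambda>t. emb P (x t)) u \<longrightarrow>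
       aeq T (full_op T p P x)
         (\<lambda>t. to_dual (emb P) (split_op T p P1 E1 R1 u t + split_op T p P2 E2 R2 u t)))"


section \<open>The splitting schemes\<close>

definition peaceman_rachford ::
    "real \<Rightarrow> real \<Rightarrow> ((real \<Rightarrow> 'h::real_vector) \<Rightarrow> (real \<Rightarrow> 'h)) \<Rightarrow> ((real \<Rightarrow> 'h) \<Rightarrow> (real \<Rightarrow> 'h)) \<Rightarrow>
      (nat \<Rightarrow> real \<Rightarrow> 'h) \<Rightarrow> (nat \<Rightarrow> real \<Rightarrow> 'h) \<Rightarrow> bool"
  where "peaceman_rachford T s F1 F2 u1 u2 \<longleftrightarrow>
    (\<forall>n. aeq T (\<lambda>t. s *\<^sub>R u1 (Suc n) t + F1 (u1 (Suc n)) t) (\<lambda>t. s *\<^sub>R u2 n t - F2 (u2 n) t) \<and>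
         aeq T (\<lambda>t. s *\<^sub>R u2 (Suc n) t + F2 (u2 (Suc n)) t)
               (\<lambda>t. s *\<^sub>R u1 (Suc n) t - F1 (u1 (Suc n)) t))"

definition douglas_rachford ::
    "real \<Rightarrow> real \<Rightarrow> ((real \<Rightarrow> 'h::real_vector) \<Rightarrow> (real \<Rightarrow> 'h)) \<Rightarrow> ((real \<Rightarrow> 'h) \<Rightarrow> (real \<Rightarrow> 'h)) \<Rightarrow>
      (nat \<Rightarrow> real \<Rightarrow> 'h) \<Rightarrow> (nat \<Rightarrow> real \<Rightarrow> 'h) \<Rightarrow> bool"
  where "douglas_rachford T s F1 F2 u1 u2 \<longleftrightarrow>
    (\<forall>n. aeq T (\<lambda>t. s *\<^sub>R u1 (Suc n) t + F1 (u1 (Suc n)) t) (\<lambda>t. s *\<^sub>R u2 n t - F2 (u2 n) t) \<and>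
         aeq T (\<lambda>t. s *\<^sub>R u2 (Suc n) t + F2 (u2 (Suc n)) t)
               (\<lambda>t. s *\<^sub>R u1 (Suc n) t + F2 (u2 n) t))"

end

theory Submission
  imports Defs
begin

text \<open>
  Each split operator is \<open>k\<close>-monotone on \<open>L\<^sup>2(0,T;H)\<close> because \<open>d/dt M\<close> is monotone. To see the
  latter, let \<open>c\<close> be the continuous representative of \<open>M x\<close>, extended by zero to negative times.
  Symmetry and positivity of \<open>M\<close> give \<open>\<integral> (c(t) - c(t - \<tau>), x(t)) dt \<ge> 0\<close> for every \<open>\<tau> > 0\<close>, and the
  difference quotients of \<open>c\<close> converge weakly to its derivative \<open>g\<close>: on functions \<open>1\<^bsub>[0,b]\<^esub> v\<close> this is the
  fundamental theorem of calculus, and an estimate that is uniform in \<open>\<tau>\<close> extends it by a Dynkin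
  argument and density to all of \<open>L\<^sup>p(0,T;V)\<close>.

  Let \<open>e\<^sub>l\<close> be the errors and \<open>d\<^sub>l\<close> the differences \<open>F\<^sub>l u\<^sub>l - F\<^sub>l u\<close>. Since \<open>F\<^sub>1 u + F\<^sub>2 u = 0\<close>, the errors
  satisfy the scheme, and \<open>\<parallel>s e\<^sub>2 + d\<^sub>2\<parallel>\<^sup>2\<close> decreases in each step by at least
  \<open>2 s ((d\<^sub>1, e\<^sub>1) + (d\<^sub>2, e\<^sub>2)) \<ge> 2 s (k\<^sub>1 + k\<^sub>2)\<close>, which therefore tends to zero.
\<close>

section \<open>Strong measurability and Lebesgue spaces\<close>

text \<open>The obstacle is that \<open>x\<close> itself has no time derivative and \<open>M\<close>
  may be degenerate, so \<open>(M x, x)\<close> cannot be differentiated directly. Comparing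
  \<open>M x\<close> with its own backward shift uses only values of \<open>x\<close>; the price is
  a limit in the difference quotients. The weak derivative is tested with scalar functions and
  single vectors \<open>v\<close>, so the analysis is carried out for the scalar functions
  \<open>g(t) v\<close>, and no integral with values in the dual of \<open>V\<close> appears. The
  estimate uniform in \<tau> comes from Young's inequality with a free parameter \<epsilon>: the
  term carrying \<open>g\<close> receives a small factor, the term carrying the test function a
  large one. The first is fixed once and for all, the second is beaten afterwards by approximation
  in L^p. The factor \<tau> that cancels the division by \<tau> arises from translating the
  primitive of a power of the norm of \<open>g\<close>, where almost everything telescopes. In the
  energy argument, the choice of \<open>s e2 + d2\<close> as the quantity to follow is what turns
  the cross terms into the monotonicity terms.\<close>

lemma lebesgue_on_null_subset:
  assumes "N \<in> null_sets (lebesgue_on S)" "B \<subseteq> N" "S \<in> sets lebesgue"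
  shows "B \<in> null_sets (lebesgue_on S)"
proof -
  have "N \<in> null_sets lebesgue" "N \<subseteq> S"
    using assms by (auto simp: null_sets_restrict_space)
  then have "B \<in> null_sets lebesgue"
    using assms(2) by (meson negligible_iff_null_sets negligible_subset)
  then show ?thesis using \<open>N \<subseteq> S\<close> assms by (auto simp: null_sets_restrict_space)
qed

text \<open>Completeness of Lebesgue measure: preimages under \<open>f\<close> and \<open>g\<close>
  differ only inside a null set, all of whose subsets are measurable.\<close>

lemma measurable_lebesgue_on_AE:
  assumes "f \<in> measurable (lebesgue_on S) M" "AE t in lebesgue_on S. f t = g t"
    and "S \<in> sets lebesgue" "\<And>t. g t \<in> space M"
  shows "g \<in> measurable (lebesgue_on S) M"
proof (rule measurableI)
  fix A assume A: "A \<in> sets M"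
  obtain N where N: "N \<in> null_sets (lebesgue_on S)" "\<And>t. t \<in> S \<Longrightarrow> t \<notin> N \<Longrightarrow> f t = g t"
    using assms(2) by (auto elim!: AE_E3)
  have "f -` A \<inter> space (lebesgue_on S) - N \<in> sets (lebesgue_on S)"
    using measurable_sets[OF assms(1) A] N(1) by blast
  moreover have "g -` A \<inter> N \<in> sets (lebesgue_on S)"
    by (rule null_setsD2[OF lebesgue_on_null_subset[OF N(1) Int_lower2 assms(3)]])
  moreover have "g -` A \<inter> space (lebesgue_on S) =
      (f -` A \<inter> space (lebesgue_on S) - N) \<union> (g -` A \<inter> N)"
    using N sets.sets_into_space[OF null_setsD2[OF N(1)]] by (auto simp: space_restrict_space)
  ultimately show "g -` A \<inter> space (lebesgue_on S) \<in> sets (lebesgue_on S)"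
    by (metis sets.Un)
qed (use assms in auto)

lemma borel_measurable_time_AE:
  assumes "f \<in> borel_measurable (time_measure T)" "AE t in time_measure T. f t = g t"
  shows "g \<in> borel_measurable (time_measure T)"
  using assms by (rule measurable_lebesgue_on_AE) auto

lemma integrable_time_AE:
  fixes f g :: "real \<Rightarrow> real"
  assumes "integrable (time_measure T) f" "AE t in time_measure T. f t = g t"
  shows "integrable (time_measure T) g"
  by (rule integrable_cong_AE_imp[OF assms(1) borel_measurable_time_AE[OF _ assms(2)] assms(2)])
     (use assms in auto)

text \<open>Measurability itself passes between \<open>f\<close> and \<open>g\<close> by
  completeness; where it fails for one it fails for both, and both integrals have the default value
  0. Hence integrals of arbitrary representatives can be compared.\<close>

lemma integral_time_AE:
  fixes f g :: "real \<Rightarrow> real"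
  assumes "AE t in time_measure T. f t = g t"
  shows "integral\<^sup>L (time_measure T) f = integral\<^sup>L (time_measure T) g"
proof (cases "f \<in> borel_measurable (time_measure T)")
  case True
  then show ?thesis using assms borel_measurable_time_AE integral_cong_AE by blast
next
  case False
  have "AE t in time_measure T. g t = f t" using assms by auto
  then have "g \<notin> borel_measurable (time_measure T)" using False borel_measurable_time_AE by blast
  then show ?thesis using False
    by (metis borel_measurable_integrable not_integrable_integral_eq)
qed

lemma borel_measurable_time_LIMSEQ:
  fixes f :: "real \<Rightarrow> real"
  assumes "\<And>n. F n \<in> borel_measurable (time_measure T)"
    and "AE t in time_measure T. (\<lambda>n::nat. F n t) \<longlonglongrightarrow> f t"
  shows "f \<in> borel_measurable (time_measure T)"
proof -
  obtain N where N: "N \<in> null_sets (time_measure T)"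
      "\<And>t. t \<in> {0..T} \<Longrightarrow> t \<notin> N \<Longrightarrow> (\<lambda>n. F n t) \<longlonglongrightarrow> f t"
    using assms(2) by (auto elim!: AE_E3)
  let ?f = "\<lambda>t. indicator (- N) t * f t"
  have "(\<lambda>t. if t \<in> N then 0 else F n t) \<in> borel_measurable (time_measure T)" for n
    using N(1) assms(1) by (intro measurable_If_set) auto
  then have "?f \<in> borel_measurable (time_measure T)"
    by (rule borel_measurable_LIMSEQ_real[where u = "\<lambda>n t. if t \<in> N then 0 else F n t", rotated])
       (use N in \<open>auto simp: indicator_def\<close>)
  moreover have "AE t in time_measure T. ?f t = f t"
    using AE_not_in[OF N(1)] by eventually_elim (auto simp: indicator_def)
  ultimately show ?thesis by (rule borel_measurable_time_AE)
qed

text \<open>A simple function has finitely many values, so the composite is pieced together from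
  finitely many sections \<open>F t v\<close>. Giving the range the discrete sigma-algebra of
  \<open>count_space\<close> makes \<open>s\<close> measurable without any structure on its
  codomain.\<close>

lemma borel_measurable_simple_compose:
  fixes F :: "real \<Rightarrow> 'a \<Rightarrow> real"
  assumes s: "simple_function M s" and F: "\<And>v. (\<lambda>t. F t v) \<in> borel_measurable M"
  shows "(\<lambda>t. F t (s t)) \<in> borel_measurable M"
proof (rule measurable_compose_countable'[where I = "s ` space M"])
  show "s \<in> measurable M (count_space (s ` space M))"
    unfolding measurable_def
  proof (intro CollectI conjI ballI)
    fix A
    show "s -` A \<inter> space M \<in> sets M"
      using measurable_sets[OF measurable_simple_function[OF s], of A] by simp
  qed auto
  show "countable (s ` space M)" using s by (simp add: countable_finite simple_functionD(1))
qed (use F in auto)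

text \<open>Since only scalar functions are integrated, this Caratheodory-type statement replaces a theory
  of Borel measurability for functions with values in a space that need not be second countable.\<close>

lemma strongly_measurable_compose:
  fixes F :: "real \<Rightarrow> 'a::real_normed_vector \<Rightarrow> real"
  assumes f: "strongly_measurable T f"
    and F: "\<And>v. (\<lambda>t. F t v) \<in> borel_measurable (time_measure T)"
    and cont: "\<And>t. continuous_on UNIV (F t)"
  shows "(\<lambda>t. F t (f t)) \<in> borel_measurable (time_measure T)"
proof -
  obtain s where s: "\<And>n. simple_function (time_measure T) (s n)"
      "AE t in time_measure T. (\<lambda>n::nat. s n t) \<longlonglongrightarrow> f t"
    using f by (auto simp: strongly_measurable_def)
  show ?thesis
  proof (rule borel_measurable_time_LIMSEQ)
    show "(\<lambda>t. F t (s n t)) \<in> borel_measurable (time_measure T)" for n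
      by (rule borel_measurable_simple_compose[OF s(1) F])
    show "AE t in time_measure T. (\<lambda>n. F t (s n t)) \<longlonglongrightarrow> F t (f t)"
      using s(2)
    proof eventually_elim
      case (elim t)
      have "isCont (F t) (f t)" using cont by (simp add: continuous_on_eq_continuous_at)
      then show ?case using elim by (rule isCont_tendsto_compose)
    qed
  qed
qed

lemma strongly_measurable_norm:
  assumes "strongly_measurable T f"
  shows "(\<lambda>t. norm (f t)) \<in> borel_measurable (time_measure T)"
proof (rule strongly_measurable_compose[where F = "\<lambda>_ x. norm x", OF assms])
  show "continuous_on UNIV (\<lambda>x::'a. norm x)" by (rule continuous_on_norm[OF continuous_on_id])
qed simp

lemma strongly_measurable_blinfun:
  fixes f :: "real \<Rightarrow> 'a::real_normed_vector \<Rightarrow>\<^sub>L real"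
  assumes "strongly_measurable T f"
  shows "(\<lambda>t. blinfun_apply (f t) v) \<in> borel_measurable (time_measure T)"
  by (rule strongly_measurable_compose[where F = "\<lambda>_ A. blinfun_apply A v", OF assms])
     (auto intro!: continuous_intros)

text \<open>Measurability of \<open>g\<close> is asked only after evaluation at fixed vectors. The
  same lemma therefore serves functions in L^r with values in the dual and the increments of a
  continuous path.\<close>

lemma strongly_measurable_pairing:
  fixes g :: "real \<Rightarrow> 'a::real_normed_vector \<Rightarrow>\<^sub>L real"
  assumes "\<And>v. (\<lambda>t. blinfun_apply (g t) v) \<in> borel_measurable (time_measure T)"
    and "strongly_measurable T x"
  shows "(\<lambda>t. blinfun_apply (g t) (x t)) \<in> borel_measurable (time_measure T)"
  by (rule strongly_measurable_compose[OF assms(2,1)]) (auto intro!: continuous_intros)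

lemma strongly_measurable_inner:
  fixes f g :: "real \<Rightarrow> 'a::real_inner"
  assumes "strongly_measurable T f" "strongly_measurable T g"
  shows "(\<lambda>t. inner (f t) (g t)) \<in> borel_measurable (time_measure T)"
proof -
  have "(\<lambda>t. inner (f t) v) \<in> borel_measurable (time_measure T)" for v
    by (rule strongly_measurable_compose[where F = "\<lambda>_ x. inner x v", OF assms(1)])
       (auto intro!: continuous_intros)
  then show ?thesis
    by (rule strongly_measurable_compose[where F = "\<lambda>t. inner (f t)", OF assms(2)])
       (auto intro!: continuous_intros)
qed

text \<open>Any map sends a pair of simple functions to a simple function; continuity is what
  carries the pointwise limit through \<open>h\<close>. Sums and bounded linear images are both
  instances.\<close>

lemma strongly_measurable_map2:
  assumes "strongly_measurable T f" "strongly_measurable T g"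
    and "\<And>x y. isCont (\<lambda>p. h (fst p) (snd p)) (x, y)"
  shows "strongly_measurable T (\<lambda>t. h (f t) (g t))"
proof -
  obtain s where s: "\<And>n. simple_function (time_measure T) (s n)"
      "AE t in time_measure T. (\<lambda>n::nat. s n t) \<longlonglongrightarrow> f t"
    using assms by (auto simp: strongly_measurable_def)
  obtain r where r: "\<And>n. simple_function (time_measure T) (r n)"
      "AE t in time_measure T. (\<lambda>n::nat. r n t) \<longlonglongrightarrow> g t"
    using assms by (auto simp: strongly_measurable_def)
  have "AE t in time_measure T. (\<lambda>n. h (s n t) (r n t)) \<longlonglongrightarrow> h (f t) (g t)"
    using s(2) r(2)
  proof eventually_elim
    case (elim t)
    show ?case using isCont_tendsto_compose[OF assms(3) tendsto_Pair[OF elim]] by simp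
  qed
  moreover have "simple_function (time_measure T) (\<lambda>t. h (s n t) (r n t))" for n
    by (rule simple_function_compose2[OF s(1) r(1)])
  ultimately show ?thesis
    unfolding strongly_measurable_def by (intro exI[of _ "\<lambda>n t. h (s n t) (r n t)"]) auto
qed

lemma strongly_measurable_const: "strongly_measurable T (\<lambda>_. v)"
  unfolding strongly_measurable_def by (intro exI[of _ "\<lambda>_ _. v"]) auto

lemma strongly_measurable_add:
  assumes "strongly_measurable T f" "strongly_measurable T g"
  shows "strongly_measurable T (\<lambda>t. f t + g t)"
  by (rule strongly_measurable_map2[OF assms]) (auto intro!: continuous_intros)

lemma strongly_measurable_bounded_linear:
  assumes "strongly_measurable T f" "bounded_linear h"
  shows "strongly_measurable T (\<lambda>t. h (f t))"
proof (rule strongly_measurable_map2[where h = "\<lambda>x y. h x", OF assms(1) assms(1)])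
  show "isCont (\<lambda>p. h (fst p)) (x, y)" for x y
    by (rule isCont_o2[where g = h, OF _ linear_continuous_at[OF assms(2)]])
       (rule isCont_fst[OF continuous_ident])
qed

lemma strongly_measurable_AE:
  assumes "strongly_measurable T f" "aeq T f g"
  shows "strongly_measurable T g"
proof -
  obtain s where s: "\<And>n. simple_function (time_measure T) (s n)"
      "AE t in time_measure T. (\<lambda>n::nat. s n t) \<longlonglongrightarrow> f t"
    using assms by (auto simp: strongly_measurable_def)
  have "AE t in time_measure T. (\<lambda>n. s n t) \<longlonglongrightarrow> g t"
    using s(2) assms(2)[unfolded aeq_def] by eventually_elim auto
  then show ?thesis using s unfolding strongly_measurable_def by blast
qed

lemma aeq_sym: assumes "aeq T f g" shows "aeq T g f"
  using assms unfolding aeq_def by eventually_elim simp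

lemma aeq_trans: assumes "aeq T f g" "aeq T g h" shows "aeq T f h"
  using assms unfolding aeq_def by eventually_elim simp

section \<open>The spaces L^p as vector spaces of representatives\<close>

lemma Lp_AE:
  assumes "f \<in> Lp T p" "aeq T f g" shows "g \<in> Lp T p"
proof -
  have "AE t in time_measure T. norm (f t) powr p = norm (g t) powr p"
    using assms(2)[unfolded aeq_def] by eventually_elim simp
  then have "integrable (time_measure T) (\<lambda>t. norm (g t) powr p)"
    using assms(1) integrable_time_AE by (auto simp: Lp_def)
  moreover have "strongly_measurable T g"
    using assms strongly_measurable_AE by (auto simp: Lp_def)
  ultimately show ?thesis by (simp add: Lp_def)
qed

lemma powr_add_le:
  fixes a b p :: real
  assumes "0 \<le> a" "0 \<le> b" "0 \<le> p"
  shows "(a + b) powr p \<le> 2 powr p * (a powr p + b powr p)"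
proof -
  have "(a + b) powr p \<le> (2 * max a b) powr p"
    using assms by (intro powr_mono2) auto
  also have "\<dots> = 2 powr p * max a b powr p" using assms by (simp add: powr_mult)
  also have "\<dots> \<le> 2 powr p * (a powr p + b powr p)"
    by (intro mult_left_mono) (auto simp: max_def)
  finally show ?thesis .
qed

lemma Lp_add:
  assumes f: "f \<in> Lp T p" and g: "g \<in> Lp T p" and p: "0 \<le> p"
  shows "(\<lambda>t. f t + g t) \<in> Lp T p"
proof -
  have sm: "strongly_measurable T (\<lambda>t. f t + g t)"
    using f g strongly_measurable_add by (auto simp: Lp_def)
  have "integrable (time_measure T) (\<lambda>t. norm (f t + g t) powr p)"
  proof (rule Bochner_Integration.integrable_bound)
    show "integrable (time_measure T)
        (\<lambda>t. 2 powr p * (norm (f t) powr p + norm (g t) powr p))"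
      using f g by (auto simp: Lp_def)
    show "(\<lambda>t. norm (f t + g t) powr p) \<in> borel_measurable (time_measure T)"
      using strongly_measurable_norm[OF sm] by measurable
    show "AE t in time_measure T. norm (norm (f t + g t) powr p) \<le>
        norm (2 powr p * (norm (f t) powr p + norm (g t) powr p))"
    proof (rule AE_I2)
      fix t
      have "norm (f t + g t) powr p \<le> (norm (f t) + norm (g t)) powr p"
        using p by (intro powr_mono2 norm_triangle_ineq) auto
      also have "\<dots> \<le> 2 powr p * (norm (f t) powr p + norm (g t) powr p)"
        using p by (intro powr_add_le) auto
      finally show "norm (norm (f t + g t) powr p) \<le>
        norm (2 powr p * (norm (f t) powr p + norm (g t) powr p))"
        by (auto simp: abs_mult intro: order_trans[OF _ abs_ge_self])
    qed
  qed
  then show ?thesis using sm by (simp add: Lp_def)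
qed

lemma Lp_bounded_linear:
  assumes f: "f \<in> Lp T p" and h: "bounded_linear h" and p: "0 \<le> p"
  shows "(\<lambda>t. h (f t)) \<in> Lp T p"
proof -
  obtain K where K: "0 \<le> K" "\<And>x. norm (h x) \<le> norm x * K"
    using bounded_linear.nonneg_bounded[OF h] by blast
  have sm: "strongly_measurable T (\<lambda>t. h (f t))"
    using f h strongly_measurable_bounded_linear by (auto simp: Lp_def)
  have "integrable (time_measure T) (\<lambda>t. norm (h (f t)) powr p)"
  proof (rule Bochner_Integration.integrable_bound)
    show "integrable (time_measure T) (\<lambda>t. norm (f t) powr p * K powr p)"
      using f by (auto simp: Lp_def)
    show "(\<lambda>t. norm (h (f t)) powr p) \<in> borel_measurable (time_measure T)"
      using strongly_measurable_norm[OF sm] by measurable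
    show "AE t in time_measure T. norm (norm (h (f t)) powr p) \<le> norm (norm (f t) powr p * K powr p)"
      using p K by (auto simp: powr_mult[symmetric] abs_mult intro!: AE_I2 powr_mono2)
  qed
  then show ?thesis using sm by (simp add: Lp_def)
qed

lemma Lp_diff:
  assumes "f \<in> Lp T p" "g \<in> Lp T p" "0 \<le> p"
  shows "(\<lambda>t. f t - g t) \<in> Lp T p"
  using Lp_add[OF assms(1) Lp_bounded_linear[OF assms(2) bounded_linear_minus[OF bounded_linear_ident] assms(3)] assms(3)]
  by simp

lemma Lp_scaleR:
  assumes "f \<in> Lp T p" "0 \<le> p"
  shows "(\<lambda>t. c *\<^sub>R f t) \<in> Lp T p"
  by (rule Lp_bounded_linear[OF assms(1) bounded_linear_scaleR_right assms(2)])

lemma Lp_D: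
  assumes "f \<in> Lp T p"
  shows "strongly_measurable T f" "integrable (time_measure T) (\<lambda>t. norm (f t) powr p)"
  using assms by (auto simp: Lp_def)

section \<open>Young's inequality and integrability of duality pairings\<close>

lemma conj_exponent_gt_1: "1 < p \<Longrightarrow> 1 < conj_exponent p"
  by (auto simp: field_simps)

text \<open>Young's inequality without its sharp constants: compare \<open>b\<close> with \<open>a powr (1 / (p - 1))\<close>.\<close>

lemma young:
  fixes a b p \<epsilon> :: real
  assumes ab: "0 \<le> a" "0 \<le> b" and p: "1 < p" and \<epsilon>: "0 < \<epsilon>"
  shows "a * b \<le> \<epsilon> powr conj_exponent p * a powr conj_exponent p + \<epsilon> powr (- p) * b powr p"
proof -
  have basic: "a * b \<le> a powr conj_exponent p + b powr p" if "0 \<le> a" "0 \<le> b" for a b :: real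
  proof (cases "a = 0 \<or> b = 0")
    case False
    then have pos: "0 < a" "0 < b" using that by auto
    show ?thesis
    proof (cases "b \<le> a powr (1 / (p - 1))")
      case True
      have "a * b \<le> a powr 1 * a powr (1 / (p - 1))" using True pos by simp
      also have "\<dots> = a powr (1 + 1 / (p - 1))" by (rule powr_add[symmetric])
      also have "1 + 1 / (p - 1) = conj_exponent p" using p by (simp add: field_simps)
      finally show ?thesis by (smt (verit) powr_ge_zero)
    next
      case False
      have "a = (a powr (1 / (p - 1))) powr (p - 1)" using pos p by (simp add: powr_powr)
      also have "\<dots> \<le> b powr (p - 1)" using False p by (intro powr_mono2) auto
      finally have "a * b \<le> b powr (p - 1) * b powr 1" using pos by simp
      also have "\<dots> = b powr p" using powr_add[of b "p - 1" 1] by simp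
      finally show ?thesis by (smt (verit) powr_ge_zero)
    qed
  qed auto
  have "a * b = (\<epsilon> * a) * (b / \<epsilon>)" using \<epsilon> by simp
  also have "\<dots> \<le> (\<epsilon> * a) powr conj_exponent p + (b / \<epsilon>) powr p"
    using ab \<epsilon> by (intro basic) auto
  finally show ?thesis using ab \<epsilon> by (simp add: powr_mult powr_divide powr_minus_divide)
qed

text \<open>The parameter decides which factor is cheap: a small \<epsilon> damps the functional and
  charges the vector with the large factor \<open>\<epsilon> powr (- p)\<close>.\<close>

lemma blinfun_young:
  fixes A :: "'a::real_normed_vector \<Rightarrow>\<^sub>L real"
  assumes "1 < p" "0 < \<epsilon>"
  shows "\<bar>blinfun_apply A v\<bar> \<le>
    \<epsilon> powr conj_exponent p * norm A powr conj_exponent p + \<epsilon> powr (- p) * norm v powr p"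
proof -
  have "\<bar>blinfun_apply A v\<bar> \<le> norm A * norm v" using norm_blinfun[of A v] by simp
  also note young[OF norm_ge_zero norm_ge_zero assms]
  finally show ?thesis .
qed

lemma integrable_pairing:
  fixes g :: "real \<Rightarrow> 'a::real_normed_vector \<Rightarrow>\<^sub>L real"
  assumes g: "g \<in> Lp T (conj_exponent p)" and x: "x \<in> Lp T p" and p: "1 < p"
  shows "integrable (time_measure T) (\<lambda>t. blinfun_apply (g t) (x t))"
proof (rule Bochner_Integration.integrable_bound)
  show "integrable (time_measure T) (\<lambda>t. norm (g t) powr conj_exponent p + norm (x t) powr p)"
    using Lp_D[OF g] Lp_D[OF x] by simp
  show "(\<lambda>t. blinfun_apply (g t) (x t)) \<in> borel_measurable (time_measure T)"
    by (rule strongly_measurable_pairing[OF strongly_measurable_blinfun[OF Lp_D(1)[OF g]] Lp_D(1)[OF x]])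
  show "AE t in time_measure T. norm (blinfun_apply (g t) (x t)) \<le>
      norm (norm (g t) powr conj_exponent p + norm (x t) powr p)"
  proof (rule AE_I2)
    fix t
    show "norm (blinfun_apply (g t) (x t)) \<le>
        norm (norm (g t) powr conj_exponent p + norm (x t) powr p)"
      using blinfun_young[OF p zero_less_one, of "g t" "x t"] by simp
  qed
qed

lemma integrable_inner_L2:
  fixes f g :: "real \<Rightarrow> 'a::real_inner"
  assumes f: "f \<in> Lp T 2" and g: "g \<in> Lp T 2"
  shows "integrable (time_measure T) (\<lambda>t. inner (f t) (g t))"
proof (rule Bochner_Integration.integrable_bound)
  show "integrable (time_measure T) (\<lambda>t. norm (f t) powr 2 + norm (g t) powr 2)"
    using Lp_D[OF f] Lp_D[OF g] by simp
  show "(\<lambda>t. inner (f t) (g t)) \<in> borel_measurable (time_measure T)"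
    by (intro strongly_measurable_inner Lp_D[OF f] Lp_D[OF g])
  have "norm (inner (f t) (g t)) \<le> norm (f t) powr 2 + norm (g t) powr 2" for t
  proof -
    have "norm (inner (f t) (g t)) \<le> norm (f t) * norm (g t)" by (simp add: Cauchy_Schwarz_ineq2)
    also have "\<dots> \<le> (norm (f t))\<^sup>2 + (norm (g t))\<^sup>2"
    proof -
      have "0 \<le> norm (f t) * norm (g t)" by simp
      moreover have "2 * (norm (f t) * norm (g t)) \<le> (norm (f t))\<^sup>2 + (norm (g t))\<^sup>2"
        using sum_squares_bound[of "norm (f t)" "norm (g t)"] by (simp add: mult.assoc)
      ultimately show ?thesis by linarith
    qed
    finally show ?thesis by simp
  qed
  then show "AE t in time_measure T. norm (inner (f t) (g t)) \<le>
      norm (norm (f t) powr 2 + norm (g t) powr 2)"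
    by (auto intro!: AE_I2)
qed

lemma finite_time_measure: "finite_measure (time_measure T)"
  by (rule finite_measure_lebesgue_on) simp

lemma Lp_const: "(\<lambda>_. v) \<in> Lp T p"
proof -
  interpret finite_measure "time_measure T" by (rule finite_time_measure)
  show ?thesis by (simp add: Lp_def strongly_measurable_const)
qed

section \<open>From weak derivatives to integrals\<close>

lemma time_integral_eq:
  fixes f :: "real \<Rightarrow> real"
  shows "integrable (time_measure T) f \<Longrightarrow> integral\<^sup>L (time_measure T) f = integral {0..T} f"
  by (rule lebesgue_integral_eq_integral) auto

lemma time_integrable_on:
  fixes f :: "real \<Rightarrow> real"
  assumes "integrable (time_measure T) f" "0 \<le> a" "b \<le> T"
  shows "f integrable_on {a..b}"
proof -
  have "f integrable_on {0..T}" by (rule integrable_on_lebesgue_on[OF assms(1)]) auto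
  then show ?thesis by (rule integrable_on_subinterval) (use assms in auto)
qed

lemma time_integrable_continuous:
  fixes f :: "real \<Rightarrow> real"
  shows "continuous_on {0..T} f \<Longrightarrow> integrable (time_measure T) f"
  by (rule continuous_imp_integrable_real)

lemma indicator_time_measurable:
  "A \<in> sets borel \<Longrightarrow> (indicator A :: real \<Rightarrow> real) \<in> borel_measurable (time_measure T)"
  by (intro measurable_restrict_space1 borel_measurable_indicator) simp

section \<open>Continuously differentiable cutoff functions\<close>

lemma has_real_derivative_max_square:
  "((\<lambda>t::real. (max 0 t)\<^sup>2) has_real_derivative 2 * max 0 t) (at t)"
proof -
  consider "t < 0" | "t > 0" | "t = 0" by linarith
  then show ?thesis
  proof cases
    case 1
    have "((\<lambda>t::real. 0) has_real_derivative 2 * max 0 t) (at t)" using 1 by simp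
    then show ?thesis
      by (rule has_field_derivative_transform_within_open[where S = "{..<0}"]) (use 1 in auto)
  next
    case 2
    have "((\<lambda>t::real. t\<^sup>2) has_real_derivative 2 * max 0 t) (at t)"
      using 2 by (auto intro!: derivative_eq_intros)
    then show ?thesis
      by (rule has_field_derivative_transform_within_open[where S = "{0<..}"]) (use 2 in auto)
  next
    case 3
    have "((\<lambda>h::real. ((max 0 (0 + h))\<^sup>2 - (max 0 0)\<^sup>2) / h) \<longlongrightarrow> 0) (at 0)"
    proof (rule Lim_null_comparison)
      show "eventually (\<lambda>h::real. norm (((max 0 (0 + h))\<^sup>2 - (max 0 0)\<^sup>2) / h) \<le> \<bar>h\<bar>) (at 0)"
        by (intro always_eventually) (auto simp: max_def power2_eq_square)
      show "((\<lambda>h::real. \<bar>h\<bar>) \<longlongrightarrow> 0) (at 0)" by (rule tendsto_eq_intros | simp)+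
    qed
    then show ?thesis unfolding 3 DERIV_def by simp
  qed
qed

text \<open>A continuously differentiable transition from 0 to 1 on \<open>[0,2\<delta>]\<close>: its derivative is the
  second difference of \<open>max 0 t\<close>, a hat function of unit mass.\<close>

definition ramp :: "real \<Rightarrow> real \<Rightarrow> real"
  where "ramp \<delta> t = ((max 0 t)\<^sup>2 - 2 * (max 0 (t - \<delta>))\<^sup>2 + (max 0 (t - 2 * \<delta>))\<^sup>2) / (2 * \<delta>\<^sup>2)"

definition hat :: "real \<Rightarrow> real \<Rightarrow> real"
  where "hat \<delta> t = (max 0 t - 2 * max 0 (t - \<delta>) + max 0 (t - 2 * \<delta>)) / \<delta>\<^sup>2"

lemma ramp_derivative: "(ramp \<delta> has_real_derivative hat \<delta> t) (at t)"
proof -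
  have shifted: "((\<lambda>t. (max 0 (t - c))\<^sup>2) has_real_derivative 2 * max 0 (t - c)) (at t)" for c
    using DERIV_chain2[OF has_real_derivative_max_square DERIV_diff[OF DERIV_ident DERIV_const[of c]], of t]
    by simp
  have "((\<lambda>t. ((max 0 t)\<^sup>2 - 2 * (max 0 (t - \<delta>))\<^sup>2 + (max 0 (t - 2 * \<delta>))\<^sup>2) / (2 * \<delta>\<^sup>2))
      has_real_derivative
      (2 * max 0 t - 2 * (2 * max 0 (t - \<delta>)) + 2 * max 0 (t - 2 * \<delta>)) / (2 * \<delta>\<^sup>2)) (at t)"
    by (intro DERIV_cdivide DERIV_add DERIV_diff DERIV_cmult shifted has_real_derivative_max_square)
  moreover have "(2 * max 0 t - 2 * (2 * max 0 (t - \<delta>)) + 2 * max 0 (t - 2 * \<delta>)) / (2 * \<delta>\<^sup>2) = hat \<delta> t"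
  proof -
    have "(2 * a - 2 * (2 * b) + 2 * c) / (2 * d) = (a - 2 * b + c) / d" for a b c d :: real
      using mult_divide_mult_cancel_left[of 2 "a - 2 * b + c" d] by (simp add: right_diff_distrib distrib_left)
    then show ?thesis unfolding hat_def by blast
  qed
  ultimately show ?thesis unfolding ramp_def[abs_def] by simp
qed

lemma hat_nonneg: "0 < \<delta> \<Longrightarrow> 0 \<le> hat \<delta> t"
  unfolding hat_def by (auto simp: max_def)

lemma hat_eq_0: "0 < \<delta> \<Longrightarrow> t < 0 \<or> 2 * \<delta> < t \<Longrightarrow> hat \<delta> t = 0"
  unfolding hat_def by (auto simp: max_def)

lemma continuous_on_hat: "continuous_on S (hat \<delta>)"
proof -
  have "continuous_on S (\<lambda>t. (max 0 t - 2 * max 0 (t - \<delta>) + max 0 (t - 2 * \<delta>)) / \<delta>\<^sup>2)"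
    unfolding divide_inverse by (intro continuous_intros)
  then show ?thesis by (simp add: hat_def[abs_def])
qed

lemma ramp_eq_0: "0 < \<delta> \<Longrightarrow> t \<le> 0 \<Longrightarrow> ramp \<delta> t = 0"
  unfolding ramp_def by (auto simp: max_def)

lemma ramp_eq_1: "0 < \<delta> \<Longrightarrow> 2 * \<delta> \<le> t \<Longrightarrow> ramp \<delta> t = 1"
  unfolding ramp_def by (auto simp: max_def field_simps power2_eq_square)

lemma ramp_mono: "0 < \<delta> \<Longrightarrow> s \<le> t \<Longrightarrow> ramp \<delta> s \<le> ramp \<delta> t"
  by (rule DERIV_nonneg_imp_nondecreasing) (auto intro!: exI ramp_derivative hat_nonneg)

lemma ramp_bounds:
  assumes "0 < \<delta>" shows "0 \<le> ramp \<delta> t" "ramp \<delta> t \<le> 1"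
  using ramp_mono[OF assms, of "min 0 t" t] ramp_mono[OF assms, of t "max (2 * \<delta>) t"] assms
  by (auto simp: ramp_eq_0 ramp_eq_1)

lemma hat_has_integral:
  assumes "0 < \<delta>" shows "((\<lambda>t. hat \<delta> (t - a)) has_integral 1) {a..a + 2 * \<delta>}"
proof -
  have "((\<lambda>t. ramp \<delta> (t - a)) has_vector_derivative hat \<delta> (t - a)) (at t within {a..a + 2 * \<delta>})" for t
  proof -
    have "((\<lambda>t. ramp \<delta> (t - a)) has_real_derivative hat \<delta> (t - a) * 1) (at t)"
      by (rule DERIV_chain2[OF ramp_derivative]) (auto intro!: derivative_eq_intros)
    then show ?thesis
      by (simp add: has_real_derivative_iff_has_vector_derivative has_vector_derivative_at_within)
  qed
  then have "((\<lambda>t. hat \<delta> (t - a)) has_integral ramp \<delta> (a + 2 * \<delta> - a) - ramp \<delta> (a - a))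
      {a..a + 2 * \<delta>}"
    by (intro fundamental_theorem_of_calculus) (use assms in auto)
  then show ?thesis using assms by (simp add: ramp_eq_0 ramp_eq_1)
qed

lemma hat_integral_tendsto:
  fixes w :: "real \<Rightarrow> real"
  assumes w: "continuous_on {0..T} w" and a: "0 \<le> a" "a < T"
    and d: "\<And>n. 0 < d n" "d \<longlonglongrightarrow> 0"
  shows "(\<lambda>n. integral {0..T} (\<lambda>t. hat (d n) (t - a) * w t)) \<longlonglongrightarrow> w a"
proof (rule LIMSEQ_I)
  fix e :: real assume "0 < e"
  then obtain r where r: "0 < r" "\<And>t. t \<in> {0..T} \<Longrightarrow> dist t a < r \<Longrightarrow> dist (w t) (w a) < e / 2"
    using w a unfolding continuous_on_iff by (metis atLeastAtMost_iff half_gt_zero less_eq_real_def)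
  \<comment> \<open>The hat is supported on an interval of length \<open>2 * d n\<close>: the first
    bound keeps it where \<open>w\<close> is close to \<open>w a\<close>, the second keeps it inside
    the time interval.\<close>
  have "eventually (\<lambda>n. d n < min (r / 2) ((T - a) / 2)) sequentially"
    using d(2) r a by (intro order_tendstoD) auto
  then obtain N where N: "\<And>n. N \<le> n \<Longrightarrow> d n < min (r / 2) ((T - a) / 2)"
    by (auto simp: eventually_sequentially)
  show "\<exists>N. \<forall>n\<ge>N. norm (integral {0..T} (\<lambda>t. hat (d n) (t - a) * w t) - w a) < e"
  proof (intro exI allI impI)
    fix n assume "N \<le> n"
    let ?J = "{a..a + 2 * d n}"
    have Jr: "dist t a < r" if "t \<in> ?J" for t
      using N[OF \<open>N \<le> n\<close>] a that by (auto simp: dist_real_def)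
    have J: "?J \<subseteq> {0..T}" using N[OF \<open>N \<le> n\<close>] a by auto
    have "continuous_on ?J (\<lambda>t. hat (d n) (t - a) * w t)"
      by (intro continuous_intros continuous_on_compose2[OF continuous_on_hat[of UNIV]]
          continuous_on_subset[OF w J]) auto
    then have "(\<lambda>t. hat (d n) (t - a) * w t) integrable_on ?J"
      by (rule integrable_continuous_real)
    then have I: "((\<lambda>t. hat (d n) (t - a) * w t) has_integral
        integral ?J (\<lambda>t. hat (d n) (t - a) * w t)) ?J" (is "(?f has_integral ?I) _")
      by (rule integrable_integral)
    have close: "w a - e / 2 \<le> w t \<and> w t \<le> w a + e / 2" if "t \<in> ?J" for t
    proof -
      have "\<bar>w t - w a\<bar> < e / 2"
        using r(2)[OF subsetD[OF J that] Jr[OF that]] by (simp add: dist_real_def)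
      then show ?thesis by linarith
    qed
    have "?I \<le> 1 * (w a + e / 2)"
      by (rule has_integral_le[OF I has_integral_mult_left[OF hat_has_integral[OF d(1)]]])
         (use close hat_nonneg[OF d(1)] in \<open>auto intro!: mult_left_mono\<close>)
    moreover have "1 * (w a - e / 2) \<le> ?I"
      by (rule has_integral_le[OF has_integral_mult_left[OF hat_has_integral[OF d(1)]] I])
         (use close hat_nonneg[OF d(1)] in \<open>auto intro!: mult_left_mono\<close>)
    moreover have "integral {0..T} ?f = ?I"
    proof (rule integral_unique, rule has_integral_on_superset[OF I _ J])
      show "?f t = 0" if "t \<notin> ?J" for t
        using that hat_eq_0[OF d(1), of "t - a" n] by auto
    qed
    ultimately show "norm (integral {0..T} ?f - w a) < e" using \<open>0 < e\<close> by auto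
  qed
qed

text \<open>A smoothed indicator of the interval from \<open>a\<close> to \<open>b\<close>, rising
  just after \<open>a\<close> and falling just after \<open>b\<close>. Its support ends at
  \<open>b + 2 * \<delta>\<close>, which has to stay below \<open>T\<close>.\<close>

lemma test_function_ramps:
  assumes "0 < a" "a < b" "b + 2 * \<delta> < T" "0 < \<delta>"
  shows "test_function T (\<lambda>t. ramp \<delta> (t - a) - ramp \<delta> (t - b)) (\<lambda>t. hat \<delta> (t - a) - hat \<delta> (t - b))"
  unfolding test_function_def
proof (intro conjI allI)
  have *: "((\<lambda>t. ramp \<delta> (t - c)) has_real_derivative hat \<delta> (t - c)) (at t)" for c t
    using DERIV_chain2[OF ramp_derivative DERIV_diff[OF DERIV_ident DERIV_const[of c]], of \<delta> t]
    by simp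
  show "((\<lambda>t. ramp \<delta> (t - a) - ramp \<delta> (t - b)) has_real_derivative
      hat \<delta> (t - a) - hat \<delta> (t - b)) (at t)" for t
    by (rule DERIV_diff[OF * *])
  show "continuous_on UNIV (\<lambda>t. hat \<delta> (t - a) - hat \<delta> (t - b))"
    by (intro continuous_intros continuous_on_compose2[OF continuous_on_hat[of UNIV]]) auto
  have "ramp \<delta> (t - a) - ramp \<delta> (t - b) = 0" if "t \<notin> {a..b + 2 * \<delta>}" for t
    using that assms by (cases "t < a") (auto simp: ramp_eq_0 ramp_eq_1)
  then show "\<exists>l r. 0 < l \<and> l < r \<and> r < T \<and>
      (\<forall>t. t \<notin> {l..r} \<longrightarrow> ramp \<delta> (t - a) - ramp \<delta> (t - b) = 0)"
    using assms by (intro exI[of _ a] exI[of _ "b + 2 * \<delta>"]) auto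
qed

text \<open>Smoothed indicators are inserted into the weak identity. On the left their derivatives
  are two approximate identities, giving \<open>w a - w b\<close>; on the right dominated
  convergence gives the integral of \<open>g\<close> between \<open>a\<close> and
  \<open>b\<close>.\<close>

lemma weak_derivative_increment:
  fixes w g :: "real \<Rightarrow> real"
  assumes w: "continuous_on {0..T} w" and g: "integrable (time_measure T) g"
    and weak: "\<And>\<phi> \<phi>'. test_function T \<phi> \<phi>' \<Longrightarrow>
      (\<integral>t. \<phi>' t * w t \<partial>time_measure T) = - (\<integral>t. \<phi> t * g t \<partial>time_measure T)"
    and ab: "0 < a" "a < b" "b < T"
  shows "w b - w a = integral {a..b} g"
proof -
  define d where "d n = inverse (real (Suc n))" for n
  have d: "\<And>n. 0 < d n" "d \<longlonglongrightarrow> 0"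
    unfolding d_def[abs_def] using LIMSEQ_inverse_real_of_nat by auto
  define \<phi> where "\<phi> n t = ramp (d n) (t - a) - ramp (d n) (t - b)" for n t
  define \<phi>' where "\<phi>' n t = hat (d n) (t - a) - hat (d n) (t - b)" for n t
  have "eventually (\<lambda>n. d n < (T - b) / 2) sequentially"
    using d(2) ab by (intro order_tendstoD) auto
  then have ev: "eventually (\<lambda>n. (\<integral>t. \<phi>' n t * w t \<partial>time_measure T) =
      - (\<integral>t. \<phi> n t * g t \<partial>time_measure T)) sequentially"
  proof eventually_elim
    case (elim n)
    have "test_function T (\<phi> n) (\<phi>' n)"
      unfolding \<phi>_def[abs_def] \<phi>'_def[abs_def]
      by (rule test_function_ramps) (use elim ab d(1)[of n] in auto)
    then show ?case by (rule weak)
  qed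
  have cont_hat: "continuous_on {0..T} (\<lambda>t. hat (d n) (t - c) * w t)" for n c
    by (intro continuous_intros continuous_on_compose2[OF continuous_on_hat[of UNIV]] w) auto
  have split: "(\<integral>t. \<phi>' n t * w t \<partial>time_measure T) =
      integral {0..T} (\<lambda>t. hat (d n) (t - a) * w t) - integral {0..T} (\<lambda>t. hat (d n) (t - b) * w t)" for n
  proof -
    have "(\<lambda>t. \<phi>' n t * w t) = (\<lambda>t. hat (d n) (t - a) * w t - hat (d n) (t - b) * w t)"
      unfolding \<phi>'_def by (auto simp: algebra_simps)
    then show ?thesis
      using time_integrable_continuous[OF cont_hat[of n a]] time_integrable_continuous[OF cont_hat[of n b]]
      by (simp add: time_integral_eq)
  qed
  have lim1: "(\<lambda>n. \<integral>t. \<phi>' n t * w t \<partial>time_measure T) \<longlonglongrightarrow> w a - w b"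
    unfolding split by (intro tendsto_diff hat_integral_tendsto[OF w] d) (use ab in auto)
  \<comment> \<open>The interval is open on the left because a ramp starting at \<open>c\<close>
    vanishes at \<open>c\<close> and tends to 1 exactly for \<open>t > c\<close>.\<close>
  define k where "k t = indicator {a<..b} t * g t" for t
  have meas: "(\<lambda>t. \<phi> n t * g t) \<in> borel_measurable (time_measure T)" for n
  proof -
    have "continuous_on UNIV (ramp \<delta>)" for \<delta>
      using DERIV_isCont[OF ramp_derivative] by (simp add: continuous_on_eq_continuous_at)
    then have "continuous_on {0..T} (\<phi> n)"
      unfolding \<phi>_def[abs_def] by (auto intro!: continuous_intros continuous_on_compose2[where f = "\<lambda>t. t - c" for c])
    then have "\<phi> n \<in> borel_measurable (time_measure T)"
      using time_integrable_continuous by blast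
    then show ?thesis using g by measurable
  qed
  have mk: "k \<in> borel_measurable (time_measure T)"
  proof -
    have "(indicator {a<..b} :: real \<Rightarrow> real) \<in> borel_measurable (time_measure T)"
      by (rule indicator_time_measurable) simp
    then show ?thesis unfolding k_def[abs_def] using g by measurable
  qed
  have "(\<lambda>n. \<integral>t. \<phi> n t * g t \<partial>time_measure T) \<longlonglongrightarrow> (\<integral>t. k t \<partial>time_measure T)"
    and ik: "integrable (time_measure T) k"
  proof -
    have pt: "(\<lambda>n. \<phi> n t * g t) \<longlonglongrightarrow> k t" for t
    proof -
      have *: "(\<lambda>n. ramp (d n) (t - c)) \<longlonglongrightarrow> indicator {c<..} t" for c
      proof (cases "c < t")
        case True
        have "eventually (\<lambda>n. d n < (t - c) / 2) sequentially"
          using d(2) True by (intro order_tendstoD) auto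
        then have "eventually (\<lambda>n. ramp (d n) (t - c) = indicator {c<..} t) sequentially"
          by eventually_elim (use True d(1) in \<open>auto simp: ramp_eq_1\<close>)
        then show ?thesis by (rule tendsto_eventually)
      qed (use d(1) in \<open>auto simp: ramp_eq_0\<close>)
      have "indicator {a<..} t - indicator {b<..} t = (indicator {a<..b} t :: real)"
        using ab by (auto simp: indicator_def)
      then show ?thesis unfolding \<phi>_def k_def
        using tendsto_mult[OF tendsto_diff[OF *[of a] *[of b]] tendsto_const[of "g t"]] by simp
    qed
    have bd: "norm (\<phi> n t * g t) \<le> norm (g t)" for n t
      using ramp_bounds[OF d(1), of n "t - a"] ramp_bounds[OF d(1), of n "t - b"]
      unfolding \<phi>_def by (auto simp: abs_mult intro!: mult_left_le_one_le)
    show "(\<lambda>n. \<integral>t. \<phi> n t * g t \<partial>time_measure T) \<longlonglongrightarrow> (\<integral>t. k t \<partial>time_measure T)"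
      by (rule integral_dominated_convergence[OF mk meas integrable_norm[OF g]]) (use pt bd in auto)
    show "integrable (time_measure T) k"
      by (rule Bochner_Integration.integrable_bound[OF g mk]) (auto simp: k_def indicator_def)
  qed
  then have "(\<lambda>n. \<integral>t. \<phi>' n t * w t \<partial>time_measure T) \<longlonglongrightarrow> - (\<integral>t. k t \<partial>time_measure T)"
    using tendsto_cong[OF ev] tendsto_minus by fastforce
  then have "w a - w b = - (\<integral>t. k t \<partial>time_measure T)"
    using lim1 LIMSEQ_unique by blast
  also have "(\<integral>t. k t \<partial>time_measure T) = integral {0..T} k" by (rule time_integral_eq[OF ik])
  also have "\<dots> = integral {a..b} g"
  proof (rule integral_unique)
    have "(g has_integral integral {a..b} g) {a..b}"
      by (rule integrable_integral[OF time_integrable_on[OF g]]) (use ab in auto)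
    then have "(k has_integral integral {a..b} g) {a..b}"
      by (rule has_integral_spike[where S = "{a}", rotated 2]) (auto simp: k_def)
    then show "(k has_integral integral {a..b} g) {0..T}"
      by (rule has_integral_on_superset) (use ab in \<open>auto simp: k_def indicator_def\<close>)
  qed
  finally show ?thesis by simp
qed

text \<open>Test functions have compact support in the open interval, so increments are known only
  there: \<open>w\<close> minus the primitive of \<open>g\<close> is constant inside. Continuity
  carries the constant to the endpoints, and \<open>w 0 = 0\<close> identifies it.\<close>

lemma weak_derivative_integral:
  fixes w g :: "real \<Rightarrow> real"
  assumes T: "0 < T" and w: "continuous_on {0..T} w" "w 0 = 0" and g: "integrable (time_measure T) g"
    and weak: "\<And>\<phi> \<phi>'. test_function T \<phi> \<phi>' \<Longrightarrow>
      (\<integral>t. \<phi>' t * w t \<partial>time_measure T) = - (\<integral>t. \<phi> t * g t \<partial>time_measure T)"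
    and t: "t \<in> {0..T}"
  shows "w t = integral {0..t} g"
proof -
  define h where "h s = w s - integral {0..s} g" for s
  have gi: "g integrable_on {0..T}" by (rule time_integrable_on[OF g]) auto
  have h: "continuous_on (closure {0<..<T}) h"
    using T unfolding h_def[abs_def]
    by (auto intro!: continuous_intros w indefinite_integral_continuous_1 gi)
  have eq: "h a = h b" if ab: "0 < a" "a < b" "b < T" for a b
  proof -
    have "integral {0..a} g + integral {a..b} g = integral {0..b} g"
      by (rule Henstock_Kurzweil_Integration.integral_combine)
         (use ab time_integrable_on[OF g, of 0 b] in auto)
    then show ?thesis
      using weak_derivative_increment[OF w(1) g weak ab] by (simp add: h_def)
  qed
  have const: "h s = h (T / 2)" if "s \<in> {0<..<T}" for s
  proof (cases s "T / 2" rule: linorder_cases)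
    case less
    show ?thesis by (rule eq[OF _ less]) (use that T in auto)
  next
    case greater
    show ?thesis by (rule eq[OF _ greater, symmetric]) (use that T in auto)
  next
    case equal
    then show ?thesis by (rule arg_cong)
  qed
  have ext: "h s = h (T / 2)" if "s \<in> {0..T}" for s
    by (rule continuous_constant_on_closure[OF h const]) (use that T in auto)
  have "h t = h 0" using ext[OF t] ext[of 0] T by simp
  then show ?thesis using w(2) by (simp add: h_def)
qed

section \<open>Difference quotients of an integral in the dual space\<close>

text \<open>After translation both integrals are parts of the integral over
  \<open>{-\<tau>..b}\<close>, and the common part cancels. Measuring against this larger interval
  also covers \<open>b < \<tau>\<close>.\<close>

lemma integral_shift_diff:
  fixes h :: "real \<Rightarrow> real"
  assumes h: "continuous_on UNIV h" and "0 \<le> b" "0 \<le> \<tau>"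
  shows "integral {0..b} h - integral {0..b} (\<lambda>t. h (t - \<tau>)) =
    integral {b - \<tau>..b} h - integral {-\<tau>..0} h"
proof -
  have hi: "h integrable_on {l..r}" for l r
    by (rule integrable_continuous_real[OF continuous_on_subset[OF h]]) simp
  have "integral {0..b} (\<lambda>t. h (t - \<tau>)) = integral {-\<tau>..b - \<tau>} h"
    using integral_shift_real_ivl[of "-\<tau>" "-\<tau>" "b - \<tau>" h] by simp
  moreover have "integral {-\<tau>..0} h + integral {0..b} h = integral {-\<tau>..b} h"
    by (rule Henstock_Kurzweil_Integration.integral_combine) (use assms hi in auto)
  moreover have "integral {-\<tau>..b - \<tau>} h + integral {b - \<tau>..b} h = integral {-\<tau>..b} h"
    by (rule Henstock_Kurzweil_Integration.integral_combine) (use assms hi in auto)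
  ultimately show ?thesis by simp
qed

lemma left_average_tendsto:
  fixes h :: "real \<Rightarrow> real"
  assumes h: "continuous_on UNIV h" and d: "\<And>n. 0 < d n" "d \<longlonglongrightarrow> 0" "\<And>n. d n \<le> 1"
  shows "(\<lambda>n. integral {b - d n..b} h / d n) \<longlonglongrightarrow> h b"
proof -
  \<comment> \<open>The base point \<open>b - 1\<close> lies to the left of every window
    \<open>{b - d n..b}\<close> because \<open>d n \<le> 1\<close>.\<close>
  define F where "F x = integral {b - 1..x} h" for x
  have hi: "h integrable_on {l..r}" for l r
    by (rule integrable_continuous_real[OF continuous_on_subset[OF h]]) simp
  have "(F has_real_derivative h b) (at b within {b - 1..b + 1})"
    unfolding F_def[abs_def] by (rule integral_has_real_derivative[OF continuous_on_subset[OF h]]) auto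
  then have "(F has_real_derivative h b) (at b)"
    by (subst (asm) at_within_interior) auto
  then have "((\<lambda>y. (F (b + y) - F b) / y) \<longlongrightarrow> h b) (at 0)" by (simp add: DERIV_def)
  moreover have "filterlim (\<lambda>n. - d n) (at 0) sequentially"
    using d(1) tendsto_minus[OF d(2)] by (auto simp: filterlim_at intro!: always_eventually) (metis less_irrefl)
  ultimately have "(\<lambda>n. (F (b + - d n) - F b) / - d n) \<longlonglongrightarrow> h b" by (rule filterlim_compose)
  moreover have "(F (b + - d n) - F b) / - d n = integral {b - d n..b} h / d n" for n
  proof -
    have "F (b - d n) + integral {b - d n..b} h = F b"
      unfolding F_def by (rule Henstock_Kurzweil_Integration.integral_combine)
        (use d(1)[of n] d(3)[of n] hi in auto)
    then have "F (b + - d n) - F b = - integral {b - d n..b} h" by simp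
    then show ?thesis by simp
  qed
  ultimately show ?thesis by simp
qed

text \<open>The fundamental theorem enters only after evaluation at each \<open>v\<close>, that is,
  through scalar integrals. The operator \<open>M\<close> does not occur: convergence of difference
  quotients is a property of \<open>c\<close> and \<open>g\<close> alone.\<close>

locale dual_path =
  fixes T p :: real and c g :: "real \<Rightarrow> 'v::real_normed_vector \<Rightarrow>\<^sub>L real"
  assumes T_pos: "0 < T" and p_gt_1: "1 < p"
    and g_Lp: "g \<in> Lp T (conj_exponent p)"
    and c_cont: "continuous_on {0..T} c" and c_0: "c 0 = 0"
    and c_integral: "\<And>t v. t \<in> {0..T} \<Longrightarrow> blinfun_apply (c t) v = integral {0..t} (\<lambda>r. blinfun_apply (g r) v)"
begin

text \<open>Clamping extends \<open>c\<close> continuously to the whole line. Since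
  \<open>c 0 = 0\<close>, the extension vanishes for negative times, which encodes the shift
  \<open>S(\<tau>)\<close> with its zero filling.\<close>

definition clamp_time :: "real \<Rightarrow> real" where "clamp_time t = max 0 (min T t)"

definition path :: "real \<Rightarrow> 'v \<Rightarrow>\<^sub>L real" where "path t = c (clamp_time t)"

text \<open>A scalar nondecreasing function whose increments control those of \<open>path\<close>
  and can be integrated in time by translation.\<close>

definition power_integral :: "real \<Rightarrow> real"
  where "power_integral t = integral {0..clamp_time t} (\<lambda>r. norm (g r) powr conj_exponent p)"

lemma clamp_time_id: "t \<in> {0..T} \<Longrightarrow> clamp_time t = t"
  by (auto simp: clamp_time_def)

lemma clamp_time_range: "clamp_time t \<in> {0..T}"
  using T_pos by (auto simp: clamp_time_def)

lemma clamp_time_neg: "t \<le> 0 \<Longrightarrow> clamp_time t = 0"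
  by (auto simp: clamp_time_def)

lemma continuous_clamp_time: "continuous_on S clamp_time"
  unfolding clamp_time_def[abs_def] by (intro continuous_intros)

lemma continuous_path: "continuous_on S path"
  unfolding path_def[abs_def]
  by (rule continuous_on_compose2[OF c_cont continuous_clamp_time]) (use clamp_time_range in auto)

lemma continuous_path_apply: "continuous_on S (\<lambda>t. blinfun_apply (path t) v)"
  by (intro continuous_intros continuous_path)

lemma g_powr_integrable: "integrable (time_measure T) (\<lambda>t. norm (g t) powr conj_exponent p)"
  by (rule Lp_D(2)[OF g_Lp])

lemma g_apply_integrable: "integrable (time_measure T) (\<lambda>t. blinfun_apply (g t) v)"
  by (rule integrable_pairing[OF g_Lp Lp_const p_gt_1])

lemma continuous_power_integral: "continuous_on S power_integral"
  unfolding power_integral_def[abs_def]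
  by (rule continuous_on_compose2[where g = "\<lambda>t. integral {0..t} (\<lambda>r. norm (g r) powr conj_exponent p)",
        OF indefinite_integral_continuous_1[where b = T] continuous_clamp_time])
     (use clamp_time_range time_integrable_on[OF g_powr_integrable] in auto)

lemma power_integral_nonneg: "0 \<le> power_integral t"
  unfolding power_integral_def
  by (rule integral_nonneg[OF time_integrable_on[OF g_powr_integrable]]) (use clamp_time_range in auto)

lemma power_integral_le: "power_integral t \<le> power_integral T"
  unfolding power_integral_def
  by (rule integral_subset_le)
     (use clamp_time_range[of t] clamp_time_range[of T] clamp_time_id[of T] T_pos
       time_integrable_on[OF g_powr_integrable] in auto)

text \<open>Young's inequality is applied under the integral over the window between
  \<open>t - \<tau>\<close> and \<open>t\<close>. Its second term does not depend on the integration
  variable, so it contributes at most the window length \<tau>.\<close>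

lemma path_increment_bound:
  assumes t: "t \<in> {0..T}" and \<tau>: "0 \<le> \<tau>" and \<epsilon>: "0 < \<epsilon>"
  shows "\<bar>blinfun_apply (path t - path (t - \<tau>)) v\<bar> \<le>
    \<epsilon> powr conj_exponent p * (power_integral t - power_integral (t - \<tau>)) +
    \<tau> * (\<epsilon> powr (- p) * norm v powr p)"
proof -
  \<comment> \<open>Windows reaching below 0 are cut there, where \<open>path\<close> vanishes; this
    only shortens them, so \<open>t - s \<le> \<tau>\<close>.\<close>
  define s where "s = clamp_time (t - \<tau>)"
  have s: "0 \<le> s" "s \<le> t" "t - s \<le> \<tau>" "t \<le> T"
    using t \<tau> by (auto simp: s_def clamp_time_def)
  let ?G = "\<lambda>r. norm (g r) powr conj_exponent p"
  have gi: "(\<lambda>r. blinfun_apply (g r) v) integrable_on {a..b}" if "0 \<le> a" "b \<le> T" for a b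
    using time_integrable_on[OF g_apply_integrable that] .
  have Gi: "?G integrable_on {a..b}" if "0 \<le> a" "b \<le> T" for a b
    using time_integrable_on[OF g_powr_integrable that] .
  have "integral {0..s} (\<lambda>r. blinfun_apply (g r) v) + integral {s..t} (\<lambda>r. blinfun_apply (g r) v) =
      integral {0..t} (\<lambda>r. blinfun_apply (g r) v)"
    by (rule Henstock_Kurzweil_Integration.integral_combine) (use s gi in auto)
  then have "blinfun_apply (path t - path (t - \<tau>)) v = integral {s..t} (\<lambda>r. blinfun_apply (g r) v)"
    using s t unfolding path_def s_def[symmetric]
    by (simp add: clamp_time_id blinfun.diff_left c_integral)
  also have "\<bar>\<dots>\<bar> \<le> integral {s..t} (\<lambda>r. \<epsilon> powr conj_exponent p * ?G r + \<epsilon> powr (- p) * norm v powr p)"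
    unfolding real_norm_def[symmetric]
    by (rule Henstock_Kurzweil_Integration.integral_norm_bound_integral)
       (use s in \<open>auto intro!: gi Gi Henstock_Kurzweil_Integration.integrable_add
          integrable_on_mult_right blinfun_young p_gt_1 \<epsilon>\<close>)
  also have "\<dots> = \<epsilon> powr conj_exponent p * integral {s..t} ?G + (t - s) * (\<epsilon> powr (- p) * norm v powr p)"
    using Henstock_Kurzweil_Integration.integral_add[of "\<lambda>r. \<epsilon> powr conj_exponent p * ?G r" "{s..t}"
        "\<lambda>_. \<epsilon> powr (- p) * norm v powr p"] s integrable_on_mult_right[OF Gi[of s t]]
      integrable_const_ivl[of "\<epsilon> powr (- p) * norm v powr p" s t]
    by (simp add: mult.assoc)
  also have "integral {s..t} ?G = power_integral t - power_integral (t - \<tau>)"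
  proof -
    have "integral {0..s} ?G + integral {s..t} ?G = integral {0..t} ?G"
      by (rule Henstock_Kurzweil_Integration.integral_combine) (use s Gi in auto)
    then show ?thesis using t unfolding power_integral_def s_def[symmetric] by (simp add: clamp_time_id)
  qed
  also have "(t - s) * (\<epsilon> powr (- p) * norm v powr p) \<le> \<tau> * (\<epsilon> powr (- p) * norm v powr p)"
    using s by (intro mult_right_mono) auto
  finally show ?thesis by simp
qed

text \<open>The shifted difference telescopes to two strips of width \<tau>. The strip at 0 enters
  with a favourable sign, and on the strip at \<open>T\<close> the integrand is at most its final
  value.\<close>

lemma power_integral_increment:
  assumes "0 \<le> \<tau>"
  shows "(\<integral>t. power_integral t - power_integral (t - \<tau>) \<partial>time_measure T) \<le> \<tau> * power_integral T"
proof -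
  have c2: "continuous_on S (\<lambda>t. power_integral (t - \<tau>))" for S
    by (rule continuous_on_compose2[OF continuous_power_integral[of UNIV]]) (auto intro!: continuous_intros)
  have "(\<integral>t. power_integral t - power_integral (t - \<tau>) \<partial>time_measure T) =
      integral {0..T} power_integral - integral {0..T} (\<lambda>t. power_integral (t - \<tau>))"
    using time_integrable_continuous[OF continuous_power_integral] time_integrable_continuous[OF c2]
    by (simp add: time_integral_eq)
  also have "\<dots> = integral {T - \<tau>..T} power_integral - integral {-\<tau>..0} power_integral"
    by (rule integral_shift_diff[OF continuous_power_integral]) (use T_pos assms in auto)
  also have "\<dots> \<le> integral {T - \<tau>..T} power_integral"
    using integral_nonneg[OF integrable_continuous_real[OF continuous_power_integral] power_integral_nonneg]
    by simp
  also have "\<dots> \<le> integral {T - \<tau>..T} (\<lambda>_. power_integral T)"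
    by (rule integral_le) (auto intro: integrable_continuous_real continuous_power_integral power_integral_le)
  also have "\<dots> = \<tau> * power_integral T" using assms by simp
  finally show ?thesis .
qed

definition quotient_error :: "real \<Rightarrow> (real \<Rightarrow> 'v) \<Rightarrow> real \<Rightarrow> real"
  where "quotient_error \<tau> y t =
    blinfun_apply (path t - path (t - \<tau>)) (y t) / \<tau> - blinfun_apply (g t) (y t)"

lemma path_increment_integrable:
  assumes y: "y \<in> Lp T p" and \<tau>: "0 < \<tau>"
  shows "integrable (time_measure T) (\<lambda>t. blinfun_apply (path t - path (t - \<tau>)) (y t))"
proof (rule Bochner_Integration.integrable_bound)
  have c2: "continuous_on S (\<lambda>t. power_integral (t - \<tau>))" for S
    by (rule continuous_on_compose2[OF continuous_power_integral[of UNIV]]) (auto intro!: continuous_intros)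
  have c3: "continuous_on S (\<lambda>t. blinfun_apply (path (t - \<tau>)) v)" for S v
    by (rule continuous_on_compose2[OF continuous_path_apply[of UNIV]]) (auto intro!: continuous_intros)
  show "integrable (time_measure T) (\<lambda>t. power_integral t - power_integral (t - \<tau>) + \<tau> * norm (y t) powr p)"
    using time_integrable_continuous[OF continuous_power_integral] time_integrable_continuous[OF c2]
      Lp_D(2)[OF y] by simp
  have "(\<lambda>t. blinfun_apply (path t - path (t - \<tau>)) v) \<in> borel_measurable (time_measure T)" for v
    unfolding blinfun.diff_left
    by (rule borel_measurable_integrable[OF time_integrable_continuous])
       (intro continuous_intros continuous_path_apply c3)
  then show "(\<lambda>t. blinfun_apply (path t - path (t - \<tau>)) (y t)) \<in> borel_measurable (time_measure T)"
    by (rule strongly_measurable_pairing[OF _ Lp_D(1)[OF y]])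
  show "AE t in time_measure T. norm (blinfun_apply (path t - path (t - \<tau>)) (y t)) \<le>
      norm (power_integral t - power_integral (t - \<tau>) + \<tau> * norm (y t) powr p)"
  proof (rule AE_I2)
    fix t assume "t \<in> space (time_measure T)"
    then show "norm (blinfun_apply (path t - path (t - \<tau>)) (y t)) \<le>
        norm (power_integral t - power_integral (t - \<tau>) + \<tau> * norm (y t) powr p)"
      using path_increment_bound[of t \<tau> 1 "y t"] \<tau> by simp
  qed
qed

lemma quotient_error_integrable:
  assumes "y \<in> Lp T p" "0 < \<tau>"
  shows "integrable (time_measure T) (quotient_error \<tau> y)"
  unfolding quotient_error_def[abs_def]
  using path_increment_integrable[OF assms] integrable_pairing[OF g_Lp assms(1) p_gt_1] by simp

text \<open>The right-hand side is free of \<tau>: the division by \<tau> cancels against the factor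
  \<tau> from \<open>power_integral_increment\<close>. The factor 2 counts the difference quotient
  and the derivative \<open>g\<close>, each bounded by Young's inequality.\<close>

lemma quotient_error_bound:
  assumes y: "y \<in> Lp T p" and \<tau>: "0 < \<tau>" and \<epsilon>: "0 < \<epsilon>"
  shows "\<bar>integral\<^sup>L (time_measure T) (quotient_error \<tau> y)\<bar> \<le>
    2 * (\<epsilon> powr conj_exponent p * power_integral T + \<epsilon> powr (- p) * (\<integral>t. norm (y t) powr p \<partial>time_measure T))"
proof -
  let ?e = "\<epsilon> powr conj_exponent p" and ?E = "\<epsilon> powr (- p)"
  let ?\<Delta> = "\<lambda>t. power_integral t - power_integral (t - \<tau>)"
  let ?Y = "\<integral>t. norm (y t) powr p \<partial>time_measure T"
  have c2: "continuous_on S (\<lambda>t. power_integral (t - \<tau>))" for S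
    by (rule continuous_on_compose2[OF continuous_power_integral[of UNIV]]) (auto intro!: continuous_intros)
  have \<Delta>: "integrable (time_measure T) ?\<Delta>"
    using time_integrable_continuous[OF continuous_power_integral] time_integrable_continuous[OF c2]
    by simp
  let ?B = "\<lambda>t. ?e / \<tau> * ?\<Delta> t + 2 * ?E * norm (y t) powr p + ?e * norm (g t) powr conj_exponent p"
  have "\<bar>integral\<^sup>L (time_measure T) (quotient_error \<tau> y)\<bar> \<le> integral\<^sup>L (time_measure T) ?B"
  proof (rule integral_abs_bound_integral)
    show "integrable (time_measure T) (quotient_error \<tau> y)"
      by (rule quotient_error_integrable[OF y \<tau>])
    show "integrable (time_measure T) ?B"
      using \<Delta> Lp_D(2)[OF y] g_powr_integrable by simp
    fix t assume "t \<in> space (time_measure T)"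
    then have t: "t \<in> {0..T}" by simp
    have "\<bar>blinfun_apply (path t - path (t - \<tau>)) (y t) / \<tau>\<bar> \<le>
        (?e * ?\<Delta> t + \<tau> * (?E * norm (y t) powr p)) / \<tau>"
      using path_increment_bound[OF t less_imp_le[OF \<tau>] \<epsilon>, of "y t"] \<tau>
      by (simp add: divide_right_mono)
    also have "\<dots> = ?e / \<tau> * ?\<Delta> t + ?E * norm (y t) powr p"
      using \<tau> by (simp add: add_divide_distrib)
    finally show "\<bar>quotient_error \<tau> y t\<bar> \<le> ?B t"
      using blinfun_young[OF p_gt_1 \<epsilon>, of "g t" "y t"] unfolding quotient_error_def by linarith
  qed
  also have "\<dots> = ?e / \<tau> * integral\<^sup>L (time_measure T) ?\<Delta> + 2 * ?E * ?Y + ?e * power_integral T"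
    using \<Delta> Lp_D(2)[OF y] g_powr_integrable T_pos
    by (simp add: time_integral_eq[OF g_powr_integrable] power_integral_def clamp_time_id)
  also have "\<dots> \<le> ?e / \<tau> * (\<tau> * power_integral T) + 2 * ?E * ?Y + ?e * power_integral T"
    using power_integral_increment[of \<tau>] \<tau> by (intro add_right_mono mult_left_mono) auto
  also have "\<dots> = 2 * (?e * power_integral T + ?E * ?Y)"
    using \<tau> by (simp add: algebra_simps)
  finally show ?thesis .
qed

text \<open>One sequence of shifts is fixed, since the limit serves only to pass a sign on to the
  pairing. It stays below 1, as \<open>left_average_tendsto\<close> requires.\<close>

definition step :: "nat \<Rightarrow> real" where "step n = inverse (real (Suc n))"

lemma step_seq: "0 < step n" "step n \<le> 1" "step \<longlonglongrightarrow> 0"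
  unfolding step_def[abs_def] using LIMSEQ_inverse_real_of_nat by (auto simp: inverse_le_1_iff)

text \<open>Membership in L^p is part of the predicate so that an induction hypothesis also delivers
  the integrability needed to split integrals.\<close>

definition error_vanishes :: "(real \<Rightarrow> 'v) \<Rightarrow> bool"
  where "error_vanishes y \<longleftrightarrow> y \<in> Lp T p \<and>
    (\<lambda>n. integral\<^sup>L (time_measure T) (quotient_error (step n) y)) \<longlonglongrightarrow> 0"

text \<open>The order of choices matters: \<epsilon> depends only on \<open>e\<close> and on
  \<open>g\<close> and makes the term with \<open>g\<close> small; only then is the distance \<eta>
  chosen to absorb the large factor \<open>\<epsilon> powr (- p)\<close>.\<close>

lemma error_vanishes_close:
  assumes y: "y \<in> Lp T p"
    and close: "\<And>\<eta>. 0 < \<eta> \<Longrightarrow> \<exists>z. error_vanishes z \<and> (\<integral>t. norm (y t - z t) powr p \<partial>time_measure T) \<le> \<eta>"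
  shows "error_vanishes y"
  unfolding error_vanishes_def
proof (intro conjI y LIMSEQ_I)
  fix e :: real assume e: "0 < e"
  define K where "K = power_integral T"
  have K: "0 \<le> K" unfolding K_def by (rule power_integral_nonneg)
  \<comment> \<open>Solves \<open>\<epsilon> powr conj_exponent p = e / (8 * (K + 1))\<close>;
    adding 1 guards against \<open>K = 0\<close>. The two terms of the bound then contribute
    \<open>e / 4\<close> each, and the approximant \<open>z\<close> less than
    \<open>e / 4\<close>.\<close>
  define \<epsilon> where "\<epsilon> = (e / (8 * (K + 1))) powr (1 / conj_exponent p)"
  have \<epsilon>: "0 < \<epsilon>" using e K by (simp add: \<epsilon>_def)
  have "1 / conj_exponent p * conj_exponent p = 1" using p_gt_1 by simp
  then have eq: "\<epsilon> powr conj_exponent p = e / (8 * (K + 1))"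
    unfolding \<epsilon>_def powr_powr using e K by simp
  have 1: "2 * (\<epsilon> powr conj_exponent p * K) \<le> e / 4"
    unfolding eq using e K by (simp add: field_simps)
  define \<eta> where "\<eta> = e / (8 * \<epsilon> powr (- p))"
  have \<eta>: "0 < \<eta>" using e \<epsilon> by (simp add: \<eta>_def)
  have 2: "2 * (\<epsilon> powr (- p) * \<eta>) = e / 4" using \<epsilon> by (simp add: \<eta>_def)
  obtain z where z: "error_vanishes z" "(\<integral>t. norm (y t - z t) powr p \<partial>time_measure T) \<le> \<eta>"
    using close[OF \<eta>] by blast
  then have zL: "z \<in> Lp T p" by (simp add: error_vanishes_def)
  obtain N where N: "\<And>n. N \<le> n \<Longrightarrow> \<bar>integral\<^sup>L (time_measure T) (quotient_error (step n) z)\<bar> < e / 4"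
    using LIMSEQ_D[of _ 0 "e / 4"] z(1) e unfolding error_vanishes_def by fastforce
  show "\<exists>N. \<forall>n\<ge>N. norm (integral\<^sup>L (time_measure T) (quotient_error (step n) y) - 0) < e"
  proof (intro exI allI impI)
    fix n assume n: "N \<le> n"
    have yz: "(\<lambda>t. y t - z t) \<in> Lp T p" using Lp_diff[OF y zL] p_gt_1 by simp
    have "quotient_error (step n) y = (\<lambda>t. quotient_error (step n) z t + quotient_error (step n) (\<lambda>t. y t - z t) t)"
      unfolding quotient_error_def by (simp add: blinfun.diff_right diff_divide_distrib)
    then have split: "integral\<^sup>L (time_measure T) (quotient_error (step n) y) =
        integral\<^sup>L (time_measure T) (quotient_error (step n) z) +
        integral\<^sup>L (time_measure T) (quotient_error (step n) (\<lambda>t. y t - z t))"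
      using quotient_error_integrable[OF zL step_seq(1)] quotient_error_integrable[OF yz step_seq(1)] by simp
    have "\<epsilon> powr (- p) * (\<integral>t. norm (y t - z t) powr p \<partial>time_measure T) \<le> \<epsilon> powr (- p) * \<eta>"
      using z(2) by (intro mult_left_mono) auto
    then have "\<bar>integral\<^sup>L (time_measure T) (quotient_error (step n) (\<lambda>t. y t - z t))\<bar> \<le> e / 2"
      using quotient_error_bound[OF yz step_seq(1)[of n] \<epsilon>] 1 2 unfolding K_def by argo
    then show "norm (integral\<^sup>L (time_measure T) (quotient_error (step n) y) - 0) < e"
      using N[OF n] split by simp
  qed
qed

end

section \<open>Extension of the limit from initial intervals to all of L^p\<close>

lemma indicator_Lp:
  assumes "(indicator B :: real \<Rightarrow> real) \<in> borel_measurable (time_measure T)"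
  shows "(\<lambda>t. (indicator B t :: real) *\<^sub>R v) \<in> Lp T p"
proof -
  have B: "B \<inter> {0..T} \<in> sets (time_measure T)"
    using assms by (simp add: borel_measurable_indicator_iff Int_commute)
  have "simple_function (time_measure T) (indicator (B \<inter> {0..T}) :: real \<Rightarrow> real)"
    by (rule simple_function_indicator[OF B])
  then have "simple_function (time_measure T) (indicator B :: real \<Rightarrow> real)"
    by (rule simple_function_cong[THEN iffD1, rotated]) (auto simp: indicator_def)
  then have "simple_function (time_measure T) (\<lambda>t. (indicator B t :: real) *\<^sub>R v)"
    by (rule simple_function_compose1)
  then have sm: "strongly_measurable T (\<lambda>t. (indicator B t :: real) *\<^sub>R v)"
    unfolding strongly_measurable_def by (intro exI[of _ "\<lambda>_ t. indicator B t *\<^sub>R v"]) auto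
  have "integrable (time_measure T) (\<lambda>t. norm ((indicator B t :: real) *\<^sub>R v) powr p)"
  proof (rule Bochner_Integration.integrable_bound)
    show "integrable (time_measure T) (\<lambda>_. norm v powr p)"
      using Lp_D(2)[OF Lp_const] .
    show "(\<lambda>t. norm ((indicator B t :: real) *\<^sub>R v) powr p) \<in> borel_measurable (time_measure T)"
      using strongly_measurable_norm[OF sm] by measurable
  qed (auto simp: indicator_def)
  then show ?thesis using sm by (simp add: Lp_def)
qed

context dual_path begin

lemma quotient_error_AE:
  assumes "AE t in time_measure T. y t = z t"
  shows "integral\<^sup>L (time_measure T) (quotient_error \<tau> y) = integral\<^sup>L (time_measure T) (quotient_error \<tau> z)"
  by (rule integral_time_AE) (use assms in \<open>eventually_elim, simp add: quotient_error_def\<close>)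

lemma error_vanishes_AE:
  assumes "error_vanishes y" "AE t in time_measure T. y t = z t"
  shows "error_vanishes z"
  using assms(1) quotient_error_AE[OF assms(2)] Lp_AE[of y T p z] assms(2)
  unfolding error_vanishes_def aeq_def by auto

lemma error_vanishes_add:
  assumes "error_vanishes y" "error_vanishes z" shows "error_vanishes (\<lambda>t. y t + z t)"
proof -
  have L: "y \<in> Lp T p" "z \<in> Lp T p" using assms by (auto simp: error_vanishes_def)
  have "quotient_error \<tau> (\<lambda>t. y t + z t) = (\<lambda>t. quotient_error \<tau> y t + quotient_error \<tau> z t)" for \<tau>
    unfolding quotient_error_def by (auto simp: blinfun.add_right add_divide_distrib)
  then have "integral\<^sup>L (time_measure T) (quotient_error (step n) (\<lambda>t. y t + z t)) =
      integral\<^sup>L (time_measure T) (quotient_error (step n) y) +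
      integral\<^sup>L (time_measure T) (quotient_error (step n) z)" for n
    using quotient_error_integrable[OF L(1) step_seq(1)] quotient_error_integrable[OF L(2) step_seq(1)]
    by simp
  then show ?thesis
    using assms tendsto_add[of _ 0 sequentially _ 0] Lp_add[OF L] p_gt_1 unfolding error_vanishes_def by fastforce
qed

lemma error_vanishes_uminus:
  assumes "error_vanishes y" shows "error_vanishes (\<lambda>t. - y t)"
proof -
  have "quotient_error \<tau> (\<lambda>t. - y t) = (\<lambda>t. - quotient_error \<tau> y t)" for \<tau>
    unfolding quotient_error_def by (simp add: blinfun.minus_right)
  then have "integral\<^sup>L (time_measure T) (quotient_error (step n) (\<lambda>t. - y t)) =
      - integral\<^sup>L (time_measure T) (quotient_error (step n) y)" for n
    by simp
  then show ?thesis
    using assms tendsto_minus[of _ 0 sequentially] Lp_scaleR[of y T p "-1"] p_gt_1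
    unfolding error_vanishes_def by fastforce
qed

lemma error_vanishes_0: "error_vanishes (\<lambda>_. 0)"
  unfolding error_vanishes_def quotient_error_def[abs_def] by (simp add: Lp_const)

lemma error_vanishes_sum: "finite I \<Longrightarrow> (\<And>i. i \<in> I \<Longrightarrow> error_vanishes (f i)) \<Longrightarrow> error_vanishes (\<lambda>t. \<Sum>i\<in>I. f i t)"
  by (induction I rule: finite_induct) (auto intro: error_vanishes_0 error_vanishes_add)

text \<open>Only the scalar function \<open>path t v\<close> is involved. Its shifted difference
  leaves the left average at \<open>b\<close>, which tends to \<open>path b v\<close>, while the
  strip before 0 vanishes; the derivative term integrates to the same value
  \<open>path b v\<close>.\<close>

lemma error_vanishes_initial_interval:
  assumes b: "0 \<le> b" "b \<le> T"
  shows "error_vanishes (\<lambda>t. (indicator {..b} t :: real) *\<^sub>R v)"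
proof -
  let ?y = "\<lambda>t. (indicator {..b} t :: real) *\<^sub>R v"
  have y: "?y \<in> Lp T p" by (rule indicator_Lp[OF indicator_time_measurable]) simp
  let ?G = "\<lambda>t. blinfun_apply (path t) v"
  let ?q = "\<lambda>\<tau> t. (?G t - ?G (t - \<tau>)) / \<tau> - blinfun_apply (g t) v"
  have Gb: "?G b = integral {0..b} (\<lambda>t. blinfun_apply (g t) v)"
    using b by (simp add: path_def clamp_time_id c_integral)
  have c3: "continuous_on S (\<lambda>t. ?G (t - \<tau>))" for S \<tau>
    by (rule continuous_on_compose2[OF continuous_path_apply[of UNIV]]) (auto intro!: continuous_intros)
  have gi: "(\<lambda>t. blinfun_apply (g t) v) integrable_on {0..b}"
    by (rule time_integrable_on[OF g_apply_integrable]) (use b in auto)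
  have "integral\<^sup>L (time_measure T) (quotient_error \<tau> ?y) =
      integral {b - \<tau>..b} ?G / \<tau> - ?G b" if \<tau>: "0 < \<tau>" for \<tau>
  proof -
    have Gi: "?G integrable_on {l..r}" "(\<lambda>t. ?G (t - \<tau>)) integrable_on {l..r}" for l r
      by (intro integrable_continuous_real continuous_path_apply c3)+
    have Qi: "(\<lambda>t. (?G t - ?G (t - \<tau>)) / \<tau>) integrable_on {0..b}"
      using integrable_on_divide[OF Henstock_Kurzweil_Integration.integrable_diff[OF Gi]] .
    have qi: "?q \<tau> integrable_on {0..b}"
      by (rule Henstock_Kurzweil_Integration.integrable_diff[OF Qi gi])
    have "integral\<^sup>L (time_measure T) (quotient_error \<tau> ?y) = integral {0..T} (quotient_error \<tau> ?y)"
      by (rule time_integral_eq[OF quotient_error_integrable[OF y \<tau>]])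
    also have "\<dots> = integral {0..T} (\<lambda>t. if t \<in> {0..b} then ?q \<tau> t else 0)"
      by (rule Henstock_Kurzweil_Integration.integral_cong)
         (auto simp: quotient_error_def blinfun.diff_left)
    also have "\<dots> = integral ({0..b} \<inter> {0..T}) (?q \<tau>)"
      by (rule Henstock_Kurzweil_Integration.integral_restrict_Int)
    also have "\<dots> = integral {0..b} (?q \<tau>)"
      by (rule arg_cong[where f = "\<lambda>S. integral S (?q \<tau>)"]) (use b in auto)
    also have "\<dots> = integral {0..b} (\<lambda>t. (?G t - ?G (t - \<tau>)) / \<tau>) - integral {0..b} (\<lambda>t. blinfun_apply (g t) v)"
      by (rule Henstock_Kurzweil_Integration.integral_diff[OF Qi gi])
    also have "integral {0..b} (\<lambda>t. (?G t - ?G (t - \<tau>)) / \<tau>) =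
        (integral {0..b} ?G - integral {0..b} (\<lambda>t. ?G (t - \<tau>))) / \<tau>"
      by (simp add: integral_divide Henstock_Kurzweil_Integration.integral_diff[OF Gi])
    also have "integral {0..b} ?G - integral {0..b} (\<lambda>t. ?G (t - \<tau>)) =
        integral {b - \<tau>..b} ?G - integral {-\<tau>..0} ?G"
      by (rule integral_shift_diff[OF continuous_path_apply]) (use b \<tau> in auto)
    also have "integral {-\<tau>..0} ?G = integral {-\<tau>..0} (\<lambda>_. 0)"
      by (rule Henstock_Kurzweil_Integration.integral_cong)
         (simp add: path_def clamp_time_neg c_0)
    finally show ?thesis using Gb by simp
  qed
  moreover have "(\<lambda>n. integral {b - step n..b} ?G / step n - ?G b) \<longlonglongrightarrow> ?G b - ?G b"
    by (intro tendsto_diff tendsto_const left_average_tendsto continuous_path_apply step_seq)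
  ultimately show ?thesis using y step_seq(1) unfolding error_vanishes_def by simp
qed

text \<open>Half-lines form an intersection-stable generator of the Borel sets. Complements and
  disjoint unions keep the property by linearity and by closedness in L^p.\<close>

lemma error_vanishes_borel:
  assumes "B \<in> sets borel"
  shows "error_vanishes (\<lambda>t. (indicator B t :: real) *\<^sub>R v)"
proof -
  have borel: "sigma_sets UNIV (range (\<lambda>a::real. {..a})) = sets borel"
    by (simp add: borel_eq_atMost)
  have "Int_stable (range (\<lambda>a::real. {..a}))"
    by (auto simp: Int_stable_def)
  moreover have "range (\<lambda>a::real. {..a}) \<subseteq> Pow UNIV" by simp
  moreover have "B \<in> sigma_sets UNIV (range (\<lambda>a::real. {..a}))" using assms borel by simp
  ultimately show ?thesis
  proof (induction rule: sigma_sets_induct_disjoint)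
    case (basic A)
    then obtain b where A: "A = {..b}" by auto
    show ?case
    proof (cases "b < 0")
      case True
      show ?thesis by (rule error_vanishes_AE[OF error_vanishes_0]) (use A True in \<open>auto intro!: AE_I2\<close>)
    next
      case False
      \<comment> \<open>Both half-lines have the same trace on the time interval.\<close>
      have "error_vanishes (\<lambda>t. (indicator {..min b T} t :: real) *\<^sub>R v)"
        by (rule error_vanishes_initial_interval) (use False T_pos in auto)
      then show ?thesis
        by (rule error_vanishes_AE) (use A in \<open>auto intro!: AE_I2 simp: indicator_def\<close>)
    qed
  next
    case empty
    show ?case using error_vanishes_0 by simp
  next
    case (compl A)
    \<comment> \<open>Within the time interval \<open>{..T}\<close> plays the role of the whole
      line, so the complement becomes a difference of two admissible functions.\<close>
    have "error_vanishes (\<lambda>t. (indicator {..T} t :: real) *\<^sub>R v + - ((indicator A t :: real) *\<^sub>R v))"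
      by (intro error_vanishes_add error_vanishes_uminus error_vanishes_initial_interval compl) (use T_pos in auto)
    then show ?case
      by (rule error_vanishes_AE) (auto intro!: AE_I2 simp: indicator_def)
  next
    case (union A)
    have Ab: "A i \<in> sets borel" for i using union(2) borel by auto
    then have Ub: "(\<Union>i. A i) \<in> sets borel" by blast
    let ?y = "\<lambda>t. (indicator (\<Union>i. A i) t :: real) *\<^sub>R v"
    let ?z = "\<lambda>m t. \<Sum>i<m::nat. (indicator (A i) t :: real) *\<^sub>R v"
    have yL: "?y \<in> Lp T p" by (rule indicator_Lp[OF indicator_time_measurable[OF Ub]])
    have zg: "error_vanishes (?z m)" for m by (rule error_vanishes_sum) (use union(3) in auto)
    have zL: "?z m \<in> Lp T p" for m using zg by (simp add: error_vanishes_def)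
    have z_eq: "?z m t = (indicator (\<Union>i<m. A i) t :: real) *\<^sub>R v" for m t
    proof -
      have "disjoint_family_on A {..<m}"
        using union(1) by (auto simp: disjoint_family_on_def)
      then have "(indicator (\<Union>i<m. A i) t :: real) = (\<Sum>i<m. indicator (A i) t)"
        by (intro indicator_UN_disjoint) auto
      then show ?thesis by (simp add: scaleR_left.sum)
    qed
    \<comment> \<open>At each \<open>t\<close> the partial sums are eventually exact, because
      \<open>t\<close> lies in some \<open>A i\<close> or in none; the constant
      \<open>norm v powr p\<close> dominates.\<close>
    have "(\<lambda>m. \<integral>t. norm (?y t - ?z m t) powr p \<partial>time_measure T) \<longlonglongrightarrow> (\<integral>t. 0 \<partial>time_measure T)"
    proof (rule integral_dominated_convergence)
      show "integrable (time_measure T) (\<lambda>t. norm v powr p)"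
        using Lp_D(2)[OF Lp_const] .
      show "(\<lambda>t. norm (?y t - ?z m t) powr p) \<in> borel_measurable (time_measure T)" for m
        using Lp_D(2)[OF Lp_diff[OF yL zL]] p_gt_1 by (intro borel_measurable_integrable) auto
      show "AE t in time_measure T. (\<lambda>m. norm (?y t - ?z m t) powr p) \<longlonglongrightarrow> 0"
      proof (rule AE_I2)
        fix t
        have "eventually (\<lambda>m. ?y t = ?z m t) sequentially"
        proof (cases "t \<in> (\<Union>i. A i)")
          case True
          then obtain i where i: "t \<in> A i" by blast
          show ?thesis
            using eventually_gt_at_top[of i]
          proof eventually_elim
            case (elim m)
            then have "t \<in> (\<Union>i<m. A i)" using i by blast
            then show ?case using True unfolding z_eq by simp
          qed
        next
          case False
          then show ?thesis unfolding z_eq by (auto simp: indicator_def)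
        qed
        then have "eventually (\<lambda>m. norm (?y t - ?z m t) powr p = 0) sequentially"
          by eventually_elim simp
        then show "(\<lambda>m. norm (?y t - ?z m t) powr p) \<longlonglongrightarrow> 0" by (rule tendsto_eventually)
      qed
      show "AE t in time_measure T. norm (norm (?y t - ?z m t) powr p) \<le> norm v powr p" for m
        unfolding z_eq by (auto intro!: AE_I2 simp: indicator_def)
    qed simp
    then have lim: "(\<lambda>m. \<integral>t. norm (?y t - ?z m t) powr p \<partial>time_measure T) \<longlonglongrightarrow> 0" by simp
    show ?case
    proof (rule error_vanishes_close[OF yL])
      fix \<eta> :: real assume "0 < \<eta>"
      then have "eventually (\<lambda>m. (\<integral>t. norm (?y t - ?z m t) powr p \<partial>time_measure T) < \<eta>) sequentially"
        using lim by (simp add: order_tendstoD)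
      then obtain m where "(\<integral>t. norm (?y t - ?z m t) powr p \<partial>time_measure T) < \<eta>"
        using eventually_happens'[OF sequentially_bot] by blast
      then show "\<exists>z. error_vanishes z \<and> (\<integral>t. norm (?y t - z t) powr p \<partial>time_measure T) \<le> \<eta>"
        using zg[of m] by (intro exI[of _ "?z m"]) auto
    qed
  qed
qed

text \<open>A Lebesgue set is a Borel set up to a subset of a Borel null set, and the integrals do
  not see null sets.\<close>

lemma error_vanishes_set:
  assumes "B \<in> sets (time_measure T)"
  shows "error_vanishes (\<lambda>t. (indicator B t :: real) *\<^sub>R v)"
proof -
  have "B \<in> sets (completion lborel)" using assms by (auto simp: sets_restrict_space_iff)
  then obtain S N N' where S: "B = S \<union> N" "N \<subseteq> N'" "N' \<in> null_sets lborel" "S \<in> sets lborel"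
    by (rule sets_completionE)
  have "AE t in lebesgue. t \<notin> N'"
    by (rule AE_completion[OF AE_not_in[OF S(3)]])
  then have "AE t in time_measure T. t \<notin> N'"
    by (subst AE_restrict_space_iff) (auto elim: eventually_mono)
  then have "AE t in time_measure T. (indicator S t :: real) *\<^sub>R v = (indicator B t :: real) *\<^sub>R v"
    by eventually_elim (use S in \<open>auto simp: indicator_def\<close>)
  then show ?thesis by (rule error_vanishes_AE[OF error_vanishes_borel[of S], rotated]) (use S in auto)
qed

lemma error_vanishes_simple:
  assumes s: "simple_function (time_measure T) s"
  shows "error_vanishes s"
proof -
  let ?A = "\<lambda>v. s -` {v} \<inter> space (time_measure T)"
  have "error_vanishes (\<lambda>t. \<Sum>v \<in> s ` space (time_measure T). (indicator (?A v) t :: real) *\<^sub>R v)"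
    by (rule error_vanishes_sum) (use simple_functionD[OF s] in \<open>auto intro!: error_vanishes_set\<close>)
  moreover have "(\<Sum>v \<in> s ` space (time_measure T). (indicator (?A v) t :: real) *\<^sub>R v) = s t"
    if t: "t \<in> space (time_measure T)" for t
  proof -
    have "(\<Sum>v \<in> s ` space (time_measure T). (indicator (?A v) t :: real) *\<^sub>R v) =
        (\<Sum>v \<in> s ` space (time_measure T). if v = s t then v else 0)"
      using t by (intro sum.cong) (auto simp: indicator_def)
    also have "\<dots> = s t" using t simple_functionD(1)[OF s] by (simp add: sum.delta)
    finally show ?thesis .
  qed
  ultimately show ?thesis by (blast intro: error_vanishes_AE AE_I2)
qed

lemma error_vanishes_Lp:
  assumes y: "y \<in> Lp T p"
  shows "error_vanishes y"
proof -
  obtain s where s: "\<And>n. simple_function (time_measure T) (s n)"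
      "AE t in time_measure T. (\<lambda>n::nat. s n t) \<longlonglongrightarrow> y t"
    using Lp_D(1)[OF y] by (auto simp: strongly_measurable_def)
  \<comment> \<open>The given simple functions converge only almost everywhere. Truncating them
    where they exceed twice the limit yields the integrable bound \<open>3 * norm (y t)\<close>. The
    factor 2 leaves room where \<open>y t\<close> is nonzero, so the truncation is eventually
    inactive; where \<open>y t = 0\<close> it forces the value 0.\<close>
  define A where "A n = {t \<in> space (time_measure T). norm (s n t) \<le> 2 * norm (y t)}" for n
  define z where "z n t = (indicator (A n) t :: real) *\<^sub>R s n t" for n t
  have nm: "(\<lambda>t. norm (y t)) \<in> borel_measurable (time_measure T)"
    by (rule strongly_measurable_norm[OF Lp_D(1)[OF y]])
  have zs: "simple_function (time_measure T) (z n)" for n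
  proof -
    have "simple_function (time_measure T) (\<lambda>t. norm (s n t))"
      by (rule simple_function_compose1[OF s(1)])
    then have "(\<lambda>t. norm (s n t)) \<in> borel_measurable (time_measure T)"
      by (rule borel_measurable_simple_function)
    then have "A n \<in> sets (time_measure T)" unfolding A_def using nm by measurable
    then have "simple_function (time_measure T) (indicator (A n) :: real \<Rightarrow> real)"
      by (rule simple_function_indicator)
    then show ?thesis unfolding z_def[abs_def] by (rule simple_function_compose2[OF _ s(1)])
  qed
  have zg: "error_vanishes (z n)" for n by (rule error_vanishes_simple[OF zs])
  have zL: "z n \<in> Lp T p" for n using zg by (simp add: error_vanishes_def)
  have bound: "norm (z n t - y t) \<le> 3 * norm (y t)" if "t \<in> space (time_measure T)" for n t
    using norm_triangle_ineq4[of "z n t" "y t"] that by (auto simp: z_def A_def indicator_def)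
  have "(\<lambda>n. \<integral>t. norm (y t - z n t) powr p \<partial>time_measure T) \<longlonglongrightarrow> (\<integral>t. 0 \<partial>time_measure T)"
  proof (rule integral_dominated_convergence)
    show "integrable (time_measure T) (\<lambda>t. 3 powr p * norm (y t) powr p)"
      using Lp_D(2)[OF y] by simp
    show "(\<lambda>t. norm (y t - z n t) powr p) \<in> borel_measurable (time_measure T)" for n
      using Lp_D(2)[OF Lp_diff[OF y zL]] p_gt_1 by (intro borel_measurable_integrable) auto
    show "AE t in time_measure T. (\<lambda>n. norm (y t - z n t) powr p) \<longlonglongrightarrow> 0"
      using s(2) AE_space
    proof eventually_elim
      case (elim t)
      have "(\<lambda>n. z n t) \<longlonglongrightarrow> y t"
      proof (cases "y t = 0")
        case True
        have "z n t = 0" for n using True by (auto simp: z_def A_def indicator_def)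
        then show ?thesis using True by simp
      next
        case False
        have "(\<lambda>n. norm (s n t)) \<longlonglongrightarrow> norm (y t)" by (rule tendsto_norm[OF elim(1)])
        then have "eventually (\<lambda>n. norm (s n t) < 2 * norm (y t)) sequentially"
          by (rule order_tendstoD) (use False in simp)
        then have "eventually (\<lambda>n. s n t = z n t) sequentially"
          by eventually_elim (use elim in \<open>auto simp: z_def A_def\<close>)
        then show ?thesis using elim(1) tendsto_cong by fastforce
      qed
      then have "(\<lambda>n. norm (y t - z n t)) \<longlonglongrightarrow> 0"
        using tendsto_norm[OF tendsto_diff[OF tendsto_const[of "y t"]], of "\<lambda>n. z n t" "y t"] by simp
      then show ?case using p_gt_1 by (intro tendsto_zero_powrI[where b = p]) auto
    qed
    show "AE t in time_measure T. norm (norm (y t - z n t) powr p) \<le> 3 powr p * norm (y t) powr p" for n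
      using bound p_gt_1
      by (auto intro!: AE_I2 powr_mono2 simp: powr_mult[symmetric] norm_minus_commute)
  qed simp
  then have lim: "(\<lambda>n. \<integral>t. norm (y t - z n t) powr p \<partial>time_measure T) \<longlonglongrightarrow> 0" by simp
  show ?thesis
  proof (rule error_vanishes_close[OF y])
    fix \<eta> :: real assume "0 < \<eta>"
    then have "eventually (\<lambda>n. (\<integral>t. norm (y t - z n t) powr p \<partial>time_measure T) < \<eta>) sequentially"
      using lim by (simp add: order_tendstoD)
    then obtain n where "(\<integral>t. norm (y t - z n t) powr p \<partial>time_measure T) < \<eta>"
      using eventually_happens'[OF sequentially_bot] by blast
    then show "\<exists>z. error_vanishes z \<and> (\<integral>t. norm (y t - z t) powr p \<partial>time_measure T) \<le> \<eta>"
      using zg[of n] by (intro exI[of _ "z n"]) auto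
  qed
qed

lemma quotient_tendsto:
  assumes y: "y \<in> Lp T p"
  shows "(\<lambda>n. (\<integral>t. blinfun_apply (path t - path (t - step n)) (y t) \<partial>time_measure T) / step n)
    \<longlonglongrightarrow> pairing T g y"
proof -
  have "integral\<^sup>L (time_measure T) (quotient_error (step n) y) =
      (\<integral>t. blinfun_apply (path t - path (t - step n)) (y t) \<partial>time_measure T) / step n - pairing T g y" for n
    unfolding quotient_error_def pairing_def
    using path_increment_integrable[OF y step_seq(1)] integrable_pairing[OF g_Lp y p_gt_1] by simp
  then show ?thesis using error_vanishes_Lp[OF y] unfolding error_vanishes_def by (simp add: LIM_zero_iff)
qed

end

section \<open>Monotonicity of the degenerate time derivative\<close>

lemma to_dual_apply: "blinfun_apply (to_dual j h) v = inner h (blinfun_apply j v)"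
  by (simp add: to_dual_def blinfun_inner_right.rep_eq)

lemma to_dual_diff: "to_dual j (h - k) = to_dual j h - to_dual j k"
  by (rule blinfun_eqI) (simp add: to_dual_apply blinfun.diff_left inner_diff_left)

context dual_path begin

text \<open>Symmetry and monotonicity of \<open>M\<close> give
  \<open>2 (M a - M b, a) \<ge> (M a, a) - (M b, b)\<close>, and the right-hand side telescopes under the shift.\<close>

lemma path_increment_nonneg:
  fixes j :: "'v \<Rightarrow>\<^sub>L 'h::real_inner" and M :: "'h \<Rightarrow>\<^sub>L 'h"
  assumes y: "y \<in> Lp T p"
    and mono: "\<And>u v. 0 \<le> inner (M u - M v) (u - v)" and sym: "\<And>u v. inner (M u) v = inner (M v) u"
    and cM: "AE t in time_measure T. c t = to_dual j (M (j (y t)))"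
    and \<tau>: "0 < \<tau>"
  shows "0 \<le> (\<integral>t. blinfun_apply (path t - path (t - \<tau>)) (y t) \<partial>time_measure T)"
proof -
  define q where "q t = inner (M (j (y t))) (j (y t))" for t
  \<comment> \<open>Extension by zero, matching the zero extension of \<open>path\<close> to
    negative times.\<close>
  define q0 where "q0 t = (if t \<in> {0..T} then q t else 0)" for t
  define L where "L t = blinfun_apply (path t - path (t - \<tau>)) (y t)" for t
  have pos: "0 \<le> inner (M a) a" for a using mono[of a 0] by (simp add: blinfun.zero_right)
  have q0_nonneg: "0 \<le> q0 t" for t using pos by (simp add: q0_def q_def)
  obtain N where N: "\<And>t. t \<in> space (time_measure T) - N \<Longrightarrow> c t = to_dual j (M (j (y t)))"
      "N \<in> null_sets (time_measure T)"
    using AE_E3[OF cM] by blast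
  have neg_N: "negligible N"
    using N(2) by (auto simp: null_sets_restrict_space negligible_iff_null_sets)
  have c_apply: "blinfun_apply (c t) v = inner (M (j (y t))) (j v)" if "t \<in> {0..T}" "t \<notin> N" for t v
    using N(1)[of t] that by (simp add: to_dual_apply)
  have Li: "integrable (time_measure T) L"
    unfolding L_def[abs_def] by (rule path_increment_integrable[OF y \<tau>])
  \<comment> \<open>Integrability of \<open>q\<close> comes for free from a shift by more than
    \<open>T\<close>: it moves the whole interval to negative times, so the increment is
    \<open>path t\<close> itself, and its pairing with \<open>y t\<close> is \<open>q t\<close>
    almost everywhere.\<close>
  have "integrable (time_measure T) (\<lambda>t. blinfun_apply (path t - path (t - (T + 1))) (y t))"
    by (rule path_increment_integrable[OF y]) (use T_pos in simp)
  moreover have "AE t in time_measure T. blinfun_apply (path t - path (t - (T + 1))) (y t) = q t"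
    using AE_not_in[OF N(2)] AE_space
  proof eventually_elim
    case (elim t)
    then have t: "t \<in> {0..T}" by simp
    have "path (t - (T + 1)) = 0" using t by (simp add: path_def clamp_time_neg c_0)
    then show ?case using c_apply[OF t elim(1)] t by (simp add: path_def clamp_time_id q_def)
  qed
  ultimately have "integrable (time_measure T) q" by (rule integrable_time_AE)
  then have "q integrable_on {0..T}" by (rule time_integrable_on) auto
  then have q0_UNIV: "q0 integrable_on UNIV"
    unfolding q0_def[abs_def] by (subst Henstock_Kurzweil_Integration.integrable_restrict_UNIV)
  have q0i: "q0 integrable_on {a..b}" for a b
    by (rule integrable_on_subinterval[OF q0_UNIV]) simp
  have shift: "integral {0..T} (\<lambda>t. q0 (t - \<tau>)) = integral {-\<tau>..T - \<tau>} q0"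
    using integral_shift_real_ivl[of "-\<tau>" "-\<tau>" "T - \<tau>" q0] by simp
  have q0si: "(\<lambda>t. q0 (t - \<tau>)) integrable_on {0..T}"
  proof -
    have "((\<lambda>t. q0 (t + - \<tau>)) has_integral integral {-\<tau>..T - \<tau>} q0) {-\<tau> - - \<tau>..T - \<tau> - - \<tau>}"
      by (rule has_integral_shift_real_ivl[OF integrable_integral[OF q0i]])
    then show ?thesis by (auto simp: integrable_on_def)
  qed
  have "integral {-\<tau>..T - \<tau>} q0 \<le> integral {-\<tau>..T} q0"
    by (rule integral_subset_le) (use \<tau> q0i q0_nonneg in auto)
  also have "integral {-\<tau>..T} q0 = integral {-\<tau>..0} q0 + integral {0..T} q0"
    by (rule Henstock_Kurzweil_Integration.integral_combine[symmetric]) (use \<tau> T_pos q0i in auto)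
  also have "integral {-\<tau>..0} q0 = integral {-\<tau>..0} (\<lambda>_. 0)"
    by (rule integral_spike[where S = "{0}"]) (auto simp: q0_def)
  finally have decrease: "integral {0..T} (\<lambda>t. q0 (t - \<tau>)) \<le> integral {0..T} q0"
    using shift by simp
  \<comment> \<open>The pointwise inequality uses the identity for \<open>c\<close> at
    \<open>t\<close> and at \<open>t - \<tau>\<close>, so the translate of the exceptional set is
    excluded too. On this negligible set \<open>L\<close> is overwritten by \<open>h\<close>, which
    makes the inequality hold everywhere.\<close>
  define N' where "N' = N \<union> (+) \<tau> ` N"
  have neg_N': "negligible N'" unfolding N'_def by (rule negligible_Un[OF neg_N negligible_translation[OF neg_N]])
  define h where "h t = (q0 t - q0 (t - \<tau>)) / 2" for t
  define L' where "L' t = (if t \<in> N' then h t else L t)" for t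
  have L_on: "L integrable_on {0..T}" by (rule time_integrable_on[OF Li]) auto
  have hi: "h integrable_on {0..T}"
    unfolding h_def[abs_def]
    by (rule integrable_on_divide[OF Henstock_Kurzweil_Integration.integrable_diff[OF q0i q0si]])
  have L'_on: "L' integrable_on {0..T}"
    by (rule integrable_spike[OF L_on neg_N']) (simp add: L'_def)
  have le: "h t \<le> L' t" if t: "t \<in> {0..T}" for t
  proof (cases "t \<in> N'")
    case False
    then have tN: "t \<notin> N" and tN': "t - \<tau> \<notin> N" by (auto simp: N'_def image_iff)
    let ?a = "j (y t)" and ?b = "j (y (t - \<tau>))"
    show ?thesis
    proof (cases "t - \<tau> \<ge> 0")
      case True
      then have t': "t - \<tau> \<in> {0..T}" using t \<tau> by auto
      have "L t = inner (M ?a) ?a - inner (M ?b) ?a"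
        using c_apply[OF t tN] c_apply[OF t' tN'] t t'
        by (simp add: L_def path_def clamp_time_id blinfun.diff_left)
      moreover have "0 \<le> inner (M ?a) ?a - 2 * inner (M ?b) ?a + inner (M ?b) ?b"
        using mono[of ?a ?b] sym[of ?a ?b] by (simp add: inner_diff_left inner_diff_right)
      ultimately show ?thesis using False t t' by (simp add: L'_def h_def q0_def q_def)
    next
      \<comment> \<open>Before time \<tau> the shifted terms vanish, and \<open>L t = q t\<close>
        dominates \<open>h t = q t / 2\<close> by positivity of \<open>M\<close>.\<close>
      case neg: False
      have "path (t - \<tau>) = 0" using neg by (simp add: path_def clamp_time_neg c_0)
      then have "L t = q t"
        using c_apply[OF t tN] t by (simp add: L_def path_def clamp_time_id q_def)
      then show ?thesis using False t neg pos by (simp add: L'_def h_def q0_def q_def)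
    qed
  qed (simp add: L'_def)
  have "integral {0..T} h = (integral {0..T} q0 - integral {0..T} (\<lambda>t. q0 (t - \<tau>))) / 2"
    unfolding h_def[abs_def]
    by (simp add: integral_divide Henstock_Kurzweil_Integration.integral_diff[OF q0i q0si])
  then have "0 \<le> integral {0..T} h" using decrease by simp
  also have "\<dots> \<le> integral {0..T} L'" by (rule integral_le[OF hi L'_on le])
  also have "\<dots> = integral {0..T} L"
    by (rule integral_spike[OF neg_N']) (simp add: L'_def)
  also have "\<dots> = integral\<^sup>L (time_measure T) L" by (rule time_integral_eq[OF Li, symmetric])
  finally show ?thesis unfolding L_def .
qed

lemma pairing_nonneg:
  fixes j :: "'v \<Rightarrow>\<^sub>L 'h::real_inner" and M :: "'h \<Rightarrow>\<^sub>L 'h"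
  assumes "y \<in> Lp T p"
    and "\<And>u v. 0 \<le> inner (M u - M v) (u - v)" and "\<And>u v. inner (M u) v = inner (M v) u"
    and "AE t in time_measure T. c t = to_dual j (M (j (y t)))"
  shows "0 \<le> pairing T g y"
proof (rule LIMSEQ_le_const[OF quotient_tendsto[OF assms(1)]], intro exI allI impI)
  fix n
  show "0 \<le> (\<integral>t. blinfun_apply (path t - path (t - step n)) (y t) \<partial>time_measure T) / step n"
    using path_increment_nonneg[OF assms step_seq(1)] step_seq(1)[of n] by simp
qed

end

section \<open>Weak derivatives under change of representative and subtraction\<close>

lemma weak_derivative_AE:
  assumes "aeq T w w'"
  shows "weak_derivative T w g \<longleftrightarrow> weak_derivative T w' g"
proof -
  have "(\<integral>t. \<phi>' t * blinfun_apply (w t) v \<partial>time_measure T) =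
      (\<integral>t. \<phi>' t * blinfun_apply (w' t) v \<partial>time_measure T)" for \<phi>' v
    by (rule integral_time_AE) (use assms[unfolded aeq_def] in \<open>eventually_elim, simp\<close>)
  then show ?thesis unfolding weak_derivative_def by simp
qed

text \<open>Both choices are made from the same set of weak derivatives, so they agree as functions
  and not merely almost everywhere.\<close>

lemma ddt_AE: "aeq T w w' \<Longrightarrow> ddt T r w = ddt T r w'"
  unfolding ddt_def by (simp add: weak_derivative_AE)

lemma ddt_properties:
  assumes "w \<in> ddt_dom T r"
  shows "ddt T r w \<in> Lp T r" "weak_derivative T w (ddt T r w)"
proof -
  have "\<exists>g. g \<in> Lp T r \<and> weak_derivative T w g"
    using assms by (auto simp: ddt_dom_def sobolev_W1_def)
  then have "ddt T r w \<in> Lp T r \<and> weak_derivative T w (ddt T r w)"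
    unfolding ddt_def by (rule someI_ex)
  then show "ddt T r w \<in> Lp T r" "weak_derivative T w (ddt T r w)" by auto
qed

lemma time_integrable_mult_continuous:
  fixes \<phi> f :: "real \<Rightarrow> real"
  assumes \<phi>: "continuous_on UNIV \<phi>" and f: "integrable (time_measure T) f"
  shows "integrable (time_measure T) (\<lambda>t. \<phi> t * f t)"
proof -
  have c: "continuous_on {0..T} \<phi>" by (rule continuous_on_subset[OF \<phi>]) simp
  have "bounded (\<phi> ` {0..T})"
    by (rule compact_imp_bounded[OF compact_continuous_image[OF c]]) simp
  then obtain B where B: "\<forall>t\<in>{0..T}. \<bar>\<phi> t\<bar> \<le> B" by (auto simp: bounded_iff)
  show ?thesis
  proof (rule Bochner_Integration.integrable_bound)
    show "integrable (time_measure T) (\<lambda>t. B * f t)" using f by simp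
    show "(\<lambda>t. \<phi> t * f t) \<in> borel_measurable (time_measure T)"
      using borel_measurable_integrable[OF time_integrable_continuous[OF c]] f by measurable
    show "AE t in time_measure T. norm (\<phi> t * f t) \<le> norm (B * f t)"
    proof (rule AE_I2)
      fix t assume "t \<in> space (time_measure T)"
      then have "\<bar>\<phi> t\<bar> \<le> \<bar>B\<bar>" using B by force
      then show "norm (\<phi> t * f t) \<le> norm (B * f t)" by (simp add: abs_mult mult_right_mono)
    qed
  qed
qed

text \<open>Integrability is required because the integral of a non-integrable function is 0 by
  convention, for which additivity would fail.\<close>

lemma weak_derivative_diff:
  assumes w: "weak_derivative T w1 g1" "weak_derivative T w2 g2"
    and wi: "\<And>v. integrable (time_measure T) (\<lambda>t. blinfun_apply (w1 t) v)"
      "\<And>v. integrable (time_measure T) (\<lambda>t. blinfun_apply (w2 t) v)"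
    and gi: "\<And>v. integrable (time_measure T) (\<lambda>t. blinfun_apply (g1 t) v)"
      "\<And>v. integrable (time_measure T) (\<lambda>t. blinfun_apply (g2 t) v)"
  shows "weak_derivative T (\<lambda>t. w1 t - w2 t) (\<lambda>t. g1 t - g2 t)"
  unfolding weak_derivative_def
proof (intro allI impI)
  fix \<phi> \<phi>' v assume test: "test_function T \<phi> \<phi>'"
  then have c': "continuous_on UNIV \<phi>'" by (simp add: test_function_def)
  have c: "continuous_on UNIV \<phi>"
    using test DERIV_isCont unfolding test_function_def by (meson continuous_at_imp_continuous_on)
  show "(\<integral>t. \<phi>' t * blinfun_apply (w1 t - w2 t) v \<partial>time_measure T) =
      - (\<integral>t. \<phi> t * blinfun_apply (g1 t - g2 t) v \<partial>time_measure T)"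
    using w[unfolded weak_derivative_def, rule_format, OF test, of v]
      time_integrable_mult_continuous[OF c' wi(1)[of v]] time_integrable_mult_continuous[OF c' wi(2)[of v]]
      time_integrable_mult_continuous[OF c gi(1)[of v]] time_integrable_mult_continuous[OF c gi(2)[of v]]
    by (simp add: blinfun.diff_left right_diff_distrib)
qed

lemma mass_path_diff: "mass_path P (\<lambda>t. x t - y t) = (\<lambda>t. mass_path P x t - mass_path P y t)"
  unfolding mass_path_def by (simp add: blinfun.diff_right to_dual_diff)

text \<open>By linearity of \<open>M\<close> everything is applied to \<open>x - y\<close>. The
  argument works with the difference of the two chosen derivatives, which is a weak derivative of
  \<open>M (x - y)\<close>, instead of \<open>ddt\<close> of the difference, which might select
  another representative.\<close>

lemma ddt_monotone:
  fixes P :: "('v::real_normed_vector, 'h::real_inner) problem"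
  assumes T: "0 < T" and p: "1 < p"
    and mono: "\<And>u v. 0 \<le> inner (mass P u - mass P v) (u - v)"
    and sym: "\<And>u v. inner (mass P u) v = inner (mass P v) u"
    and x: "x \<in> W_space T p P" and y: "y \<in> W_space T p P"
  shows "0 \<le> pairing T
    (\<lambda>t. ddt T (conj_exponent p) (mass_path P x) t - ddt T (conj_exponent p) (mass_path P y) t)
    (\<lambda>t. x t - y t)"
proof -
  let ?r = "conj_exponent p"
  let ?gx = "ddt T ?r (mass_path P x)" and ?gy = "ddt T ?r (mass_path P y)"
  let ?z = "\<lambda>t. x t - y t" and ?g = "\<lambda>t. ?gx t - ?gy t"
  have r: "1 < ?r" by (rule conj_exponent_gt_1[OF p])
  have wx: "mass_path P x \<in> ddt_dom T ?r" and wy: "mass_path P y \<in> ddt_dom T ?r"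
    and xL: "x \<in> Lp T p" and yL: "y \<in> Lp T p"
    using x y by (auto simp: W_space_def)
  obtain cx where cx: "continuous_on {0..T} cx" "aeq T (mass_path P x) cx" "cx 0 = 0"
    using wx by (auto simp: ddt_dom_def)
  obtain cy where cy: "continuous_on {0..T} cy" "aeq T (mass_path P y) cy" "cy 0 = 0"
    using wy by (auto simp: ddt_dom_def)
  define c where "c t = cx t - cy t" for t
  have zL: "?z \<in> Lp T p" using Lp_diff[OF xL yL] p by simp
  have gL: "?g \<in> Lp T ?r" using Lp_diff[OF ddt_properties(1)[OF wx] ddt_properties(1)[OF wy]] r by simp
  have c_cont: "continuous_on {0..T} c" unfolding c_def[abs_def] by (intro continuous_intros cx cy)
  have c_eq: "aeq T (mass_path P ?z) c"
    using cx(2) cy(2) unfolding aeq_def mass_path_diff c_def by eventually_elim simp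
  have Li: "integrable (time_measure T) (\<lambda>t. blinfun_apply (f t) v)" if "f \<in> Lp T ?r" for f :: "real \<Rightarrow> 'v dual" and v
    by (rule integrable_pairing[OF that Lp_const p])
  have "weak_derivative T (mass_path P ?z) ?g"
    unfolding mass_path_diff
    by (rule weak_derivative_diff[OF ddt_properties(2)[OF wx] ddt_properties(2)[OF wy]])
       (use wx wy ddt_properties(1) in \<open>auto intro!: Li simp: ddt_dom_def sobolev_W1_def\<close>)
  then have weak: "weak_derivative T c ?g" using weak_derivative_AE[OF c_eq] by simp
  interpret dual_path T p c ?g
  proof
    fix t v assume t: "t \<in> {0..T}"
    show "blinfun_apply (c t) v = integral {0..t} (\<lambda>r. blinfun_apply (?g r) v)"
    proof (rule weak_derivative_integral[OF T _ _ Li[OF gL] _ t])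
      show "continuous_on {0..T} (\<lambda>t. blinfun_apply (c t) v)" by (intro continuous_intros c_cont)
      show "blinfun_apply (c 0) v = 0" by (simp add: c_def cx cy)
    qed (use weak in \<open>simp add: weak_derivative_def\<close>)
  qed (use T p gL c_cont cx cy in \<open>auto simp: c_def\<close>)
  show ?thesis
  proof (rule pairing_nonneg[OF zL mono sym])
    show "AE t in time_measure T. c t = to_dual (emb P) (mass P (emb P (?z t)))"
      using c_eq unfolding aeq_def mass_path_def by eventually_elim simp
  qed
qed

section \<open>Monotonicity of the split operators\<close>

lemma full_op_AE:
  assumes "Lp_operator T p (evol Q)" "x \<in> Lp T p" "y \<in> Lp T p" "aeq T x y"
  shows "aeq T (full_op T p Q x) (full_op T p Q y)"
proof -
  have "aeq T (evol Q x) (evol Q y)" using assms by (auto simp: Lp_operator_def)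
  moreover have "aeq T (mass_path Q x) (mass_path Q y)"
    using assms(4) unfolding aeq_def mass_path_def by eventually_elim simp
  then have "ddt T (conj_exponent p) (mass_path Q x) = ddt T (conj_exponent p) (mass_path Q y)"
    by (rule ddt_AE)
  ultimately show ?thesis
    unfolding aeq_def full_op_def by (auto elim: eventually_mono)
qed

lemma W_space_AE:
  assumes "x \<in> W_space T p Q" "y \<in> Lp T p" "aeq T x y"
  shows "y \<in> W_space T p Q"
proof -
  have e: "aeq T (mass_path Q x) (mass_path Q y)"
    using assms(3) unfolding aeq_def mass_path_def by eventually_elim simp
  have "mass_path Q y \<in> sobolev_W1 T (conj_exponent p)"
    using assms(1) Lp_AE[OF _ e] weak_derivative_AE[OF e] by (auto simp: W_space_def ddt_dom_def sobolev_W1_def)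
  moreover obtain c where "continuous_on {0..T} c" "aeq T (mass_path Q x) c" "c 0 = 0"
    using assms(1) by (auto simp: W_space_def ddt_dom_def)
  ultimately show ?thesis
    using assms(2) aeq_trans[OF aeq_sym[OF e]] by (auto simp: W_space_def ddt_dom_def)
qed

lemma V_part_properties:
  assumes "x \<in> Lp T p" "aeq T (\<lambda>t. blinfun_apply j (x t)) u" "inj (blinfun_apply j)"
  shows "V_part T p j u \<in> Lp T p" "aeq T (\<lambda>t. blinfun_apply j (V_part T p j u t)) u"
    "aeq T x (V_part T p j u)"
proof -
  have "\<exists>x. x \<in> Lp T p \<and> aeq T (\<lambda>t. blinfun_apply j (x t)) u" using assms by blast
  from someI_ex[OF this, folded V_part_def] show 1: "V_part T p j u \<in> Lp T p" "aeq T (\<lambda>t. blinfun_apply j (V_part T p j u t)) u" by auto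
  show "aeq T x (V_part T p j u)"
    using assms(2) 1(2) unfolding aeq_def
    by eventually_elim (metis assms(3) injD)
qed

text \<open>\<open>split_dom\<close> asserts that some \<open>x\<close> and \<open>h\<close> exist,
  whereas \<open>split_op\<close> refers to chosen ones. Injectivity of the embedding makes every
  admissible \<open>x\<close> agree almost everywhere with the chosen one, and the properties are
  transferred along this. The function \<open>h\<close> is independent of \<open>E\<close>, hence
  the inner quantifier.\<close>

lemma split_domE:
  assumes u: "u \<in> split_dom T p Q R" and A: "Lp_operator T p (evol Q)" and inj: "inj (blinfun_apply (emb Q))"
  obtains x h where "x \<in> W_space T p Q" "aeq T (\<lambda>t. emb Q (x t)) (\<lambda>t. R (u t))"
    "h \<in> Lp T 2" "aeq T (\<lambda>t. to_dual (emb Q) (h t)) (full_op T p Q x)"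
    "\<forall>E. split_op T p Q E R u = (\<lambda>t. blinfun_apply E (h t))"
proof -
  define x where "x = V_part T p (emb Q) (\<lambda>t. R (u t))"
  define h where "h = H_part T (emb Q) (full_op T p Q x)"
  obtain x0 h0 where 0: "x0 \<in> W_space T p Q" "aeq T (\<lambda>t. emb Q (x0 t)) (\<lambda>t. R (u t))"
      "h0 \<in> Lp T 2" "aeq T (\<lambda>t. to_dual (emb Q) (h0 t)) (full_op T p Q x0)"
    using u by (auto simp: split_dom_def)
  have x0: "x0 \<in> Lp T p" using 0(1) by (simp add: W_space_def)
  note x = V_part_properties[OF x0 0(2) inj, folded x_def]
  have W: "x \<in> W_space T p Q" by (rule W_space_AE[OF 0(1) x(1,3)])
  have "\<exists>h. h \<in> Lp T 2 \<and> aeq T (\<lambda>t. to_dual (emb Q) (h t)) (full_op T p Q x)"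
    using 0(3) aeq_trans[OF 0(4) full_op_AE[OF A x0 x(1,3)]] by blast
  note h = someI_ex[OF this, folded H_part_def, folded h_def]
  show ?thesis
    by (rule that[OF W x(2)]) (use h in \<open>auto simp: split_op_def h_def x_def\<close>)
qed

lemma split_dom_subset_Lp: "split_dom T p Q R \<subseteq> Lp T 2"
  by (auto simp: split_dom_def)

lemma split_op_Lp:
  assumes "u \<in> split_dom T p Q R" "Lp_operator T p (evol Q)" "inj (blinfun_apply (emb Q))"
  shows "split_op T p Q E R u \<in> Lp T 2"
proof (rule split_domE[OF assms])
  fix h assume "h \<in> Lp T 2" and eq: "\<forall>E. split_op T p Q E R u = (\<lambda>t. blinfun_apply E (h t))"
  then have "(\<lambda>t. blinfun_apply E (h t)) \<in> Lp T 2"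
    by (intro Lp_bounded_linear[where h = "blinfun_apply E"] blinfun.bounded_linear_right) auto
  then show ?thesis using eq by simp
qed

text \<open>Since \<open>E\<close> is adjoint to \<open>R\<close>, the inner product in \<open>H\<close> becomes the duality pairing of the
  subproblem, where the time derivative contributes a nonnegative term and the source cancels.\<close>

lemma split_op_monotone:
  fixes Q :: "('w::real_normed_vector, 'g::real_inner) problem"
    and E :: "'g \<Rightarrow>\<^sub>L 'h::real_inner" and R :: "'h \<Rightarrow>\<^sub>L 'g"
  assumes T: "0 < T" and p: "1 < p"
    and u: "u \<in> split_dom T p Q R" and v: "v \<in> split_dom T p Q R"
    and A: "Lp_operator T p (evol Q)" and inj: "inj (blinfun_apply (emb Q))"
    and mono: "\<And>u v. 0 \<le> inner (mass Q u - mass Q v) (u - v)"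
    and sym: "\<And>u v. inner (mass Q u) v = inner (mass Q v) u"
    and adj: "\<And>a b. inner (E a) b = inner a (R b)"
    and k: "nonneg_functional T p k" "k_monotone T p k (evol Q)"
  shows "0 \<le> k (V_part T p (emb Q) (\<lambda>t. R (u t - v t)))"
    and "k (V_part T p (emb Q) (\<lambda>t. R (u t - v t))) \<le>
      (\<integral>t. inner (split_op T p Q E R u t - split_op T p Q E R v t) (u t - v t) \<partial>time_measure T)"
proof -
  obtain x h where x: "x \<in> W_space T p Q" "aeq T (\<lambda>t. emb Q (x t)) (\<lambda>t. R (u t))"
    "h \<in> Lp T 2" "aeq T (\<lambda>t. to_dual (emb Q) (h t)) (full_op T p Q x)"
    "\<forall>E. split_op T p Q E R u = (\<lambda>t. blinfun_apply E (h t))"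
    by (rule split_domE[OF u A inj]) (rule that)
  obtain y l where y: "y \<in> W_space T p Q" "aeq T (\<lambda>t. emb Q (y t)) (\<lambda>t. R (v t))"
    "l \<in> Lp T 2" "aeq T (\<lambda>t. to_dual (emb Q) (l t)) (full_op T p Q y)"
    "\<forall>E. split_op T p Q E R v = (\<lambda>t. blinfun_apply E (l t))"
    by (rule split_domE[OF v A inj]) (rule that)
  let ?r = "conj_exponent p"
  let ?z = "\<lambda>t. x t - y t"
  let ?D = "\<lambda>t. ddt T ?r (mass_path Q x) t - ddt T ?r (mass_path Q y) t"
  let ?A = "\<lambda>t. evol Q x t - evol Q y t"
  have L: "x \<in> Lp T p" "y \<in> Lp T p" "mass_path Q x \<in> ddt_dom T ?r" "mass_path Q y \<in> ddt_dom T ?r"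
    using x(1) y(1) by (auto simp: W_space_def)
  have r: "0 \<le> ?r" "0 \<le> p" using conj_exponent_gt_1[OF p] p by auto
  have zL: "?z \<in> Lp T p" by (rule Lp_diff[OF L(1,2) r(2)])
  have DL: "?D \<in> Lp T ?r"
    by (rule Lp_diff[OF ddt_properties(1)[OF L(3)] ddt_properties(1)[OF L(4)] r(1)])
  have AL: "?A \<in> Lp T ?r"
    by (rule Lp_diff[OF _ _ r(1)]) (use A L in \<open>auto simp: Lp_operator_def\<close>)
  have "aeq T (\<lambda>t. emb Q (?z t)) (\<lambda>t. R (u t - v t))"
    using x(2) y(2) unfolding aeq_def by eventually_elim (simp add: blinfun.diff_right)
  note V = V_part_properties[OF zL this inj]
  \<comment> \<open>\<open>k\<close> respects almost everywhere equality, so the representative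
    selected by \<open>V_part\<close> may be replaced by \<open>x - y\<close>.\<close>
  have k_eq: "k (V_part T p (emb Q) (\<lambda>t. R (u t - v t))) = k ?z"
    using k(1) V(1,3) zL unfolding nonneg_functional_def by metis
  show "0 \<le> k (V_part T p (emb Q) (\<lambda>t. R (u t - v t)))"
    using k(1) V(1) by (simp add: nonneg_functional_def)
  have "(\<integral>t. inner (split_op T p Q E R u t - split_op T p Q E R v t) (u t - v t) \<partial>time_measure T) =
      (\<integral>t. blinfun_apply (?D t) (?z t) + blinfun_apply (?A t) (?z t) \<partial>time_measure T)"
  proof (rule integral_time_AE)
    show "AE t in time_measure T. inner (split_op T p Q E R u t - split_op T p Q E R v t) (u t - v t) =
        blinfun_apply (?D t) (?z t) + blinfun_apply (?A t) (?z t)"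
      using x(2,4) y(2,4) unfolding aeq_def
    proof eventually_elim
      case (elim t)
      have "inner (split_op T p Q E R u t - split_op T p Q E R v t) (u t - v t) =
          inner (E (h t - l t)) (u t - v t)"
        by (simp add: x(5) y(5) blinfun.diff_right)
      also have "\<dots> = inner (h t - l t) (emb Q (?z t))"
        unfolding adj using elim(1,3) by (simp add: blinfun.diff_right)
      also have "\<dots> = blinfun_apply (full_op T p Q x t - full_op T p Q y t) (?z t)"
        unfolding elim(2,4)[symmetric] to_dual_diff[symmetric] by (simp add: to_dual_apply)
      also have "\<dots> = blinfun_apply (?D t + ?A t) (?z t)"
        by (rule arg_cong[where f = "\<lambda>a. blinfun_apply a (?z t)"]) (simp add: full_op_def)
      finally show ?case by (simp add: blinfun.add_left)
    qed
  qed
  also have "\<dots> = pairing T ?D ?z + pairing T ?A ?z"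
    unfolding pairing_def
    by (rule Bochner_Integration.integral_add[OF integrable_pairing[OF DL zL p] integrable_pairing[OF AL zL p]])
  finally have "(\<integral>t. inner (split_op T p Q E R u t - split_op T p Q E R v t) (u t - v t) \<partial>time_measure T) =
      pairing T ?D ?z + pairing T ?A ?z" .
  moreover have "0 \<le> pairing T ?D ?z"
    by (rule ddt_monotone[OF T p mono sym x(1) y(1)])
  moreover have "k ?z \<le> pairing T ?A ?z"
    using k(2) L(1,2) by (simp add: k_monotone_def)
  ultimately show "k (V_part T p (emb Q) (\<lambda>t. R (u t - v t))) \<le>
      (\<integral>t. inner (split_op T p Q E R u t - split_op T p Q E R v t) (u t - v t) \<partial>time_measure T)"
    unfolding k_eq by simp
qed

section \<open>Energy decay of the splitting schemes\<close>

text \<open>The polarization identity is used twice, once for the pair \<open>s e1\<close>,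
  \<open>d1\<close> and once for \<open>s e2\<close>, \<open>d2\<close>: each half step replaces a
  sum by the corresponding difference.\<close>

lemma peaceman_rachford_energy:
  fixes e1 d1 e2 d2 e d :: "'a::real_inner"
  assumes "s *\<^sub>R e1 + d1 = s *\<^sub>R e2 - d2" and "s *\<^sub>R e + d = s *\<^sub>R e1 - d1"
  shows "(norm (s *\<^sub>R e + d))\<^sup>2 = (norm (s *\<^sub>R e2 + d2))\<^sup>2 - 4 * s * (inner d1 e1 + inner d2 e2)"
proof -
  have diff: "(norm (x - y))\<^sup>2 = (norm (x + y))\<^sup>2 - 4 * inner y x" for x y :: 'a
    by (simp add: power2_norm_eq_inner inner_commute algebra_simps)
  have "(norm (s *\<^sub>R e + d))\<^sup>2 = (norm (s *\<^sub>R e1 + d1))\<^sup>2 - 4 * s * inner d1 e1"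
    unfolding assms(2) diff by simp
  also have "(norm (s *\<^sub>R e1 + d1))\<^sup>2 = (norm (s *\<^sub>R e2 + d2))\<^sup>2 - 4 * s * inner d2 e2"
    unfolding assms(1) diff by simp
  finally show ?thesis by (simp add: algebra_simps)
qed

text \<open>The gap between the two sides is exactly the squared norm of \<open>d1 + d2\<close>,
  which equals \<open>s (e2 - e1)\<close> by the first equation.\<close>

lemma douglas_rachford_energy:
  fixes e1 d1 e2 d2 e d :: "'a::real_inner"
  assumes "s *\<^sub>R e1 + d1 = s *\<^sub>R e2 - d2" and "s *\<^sub>R e + d = s *\<^sub>R e1 + d2"
  shows "(norm (s *\<^sub>R e + d))\<^sup>2 \<le> (norm (s *\<^sub>R e2 + d2))\<^sup>2 - 2 * s * (inner d1 e1 + inner d2 e2)"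
proof -
  have d1: "d1 = s *\<^sub>R e2 - d2 - s *\<^sub>R e1" using assms(1) by (simp add: algebra_simps)
  have "(norm (s *\<^sub>R e2 + d2))\<^sup>2 - 2 * s * (inner d1 e1 + inner d2 e2) - (norm (s *\<^sub>R e + d))\<^sup>2 =
      (norm (d1 + d2))\<^sup>2"
    unfolding assms(2) d1 power2_norm_eq_inner
    by (simp add: inner_commute algebra_simps)
  then show ?thesis by (smt (verit) zero_le_power2)
qed

text \<open>A decreasing sequence bounded below converges, so its increments tend to 0. The schemes
  pair \<open>k1\<close> at \<open>Suc n\<close> with \<open>k2\<close> at \<open>n\<close>, so each
  is squeezed separately before the indices are realigned; \<open>k1 0\<close> stays unconstrained,
  as no scheme determines \<open>u1 0\<close>.\<close>

lemma energy_decay_tendsto_0: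
  fixes a k1 k2 :: "nat \<Rightarrow> real"
  assumes a: "\<And>n. 0 \<le> a n" and s: "0 < s"
    and k: "\<And>n. 0 \<le> k1 (Suc n)" "\<And>n. 0 \<le> k2 n"
    and decay: "\<And>n. a (Suc n) \<le> a n - s * (k1 (Suc n) + k2 n)"
  shows "(\<lambda>n. k1 n + k2 n) \<longlonglongrightarrow> 0"
proof -
  have "0 \<le> s * (k1 (Suc n) + k2 n)" for n using s k[of n] by simp
  then have "decseq a" using decay by (intro decseq_SucI) (smt (verit))
  then obtain l where l: "a \<longlonglongrightarrow> l" using decseq_convergent[of a 0] a by blast
  have "(\<lambda>n. (a n - a (Suc n)) / s) \<longlonglongrightarrow> (l - l) / s"
    by (intro tendsto_intros l LIMSEQ_Suc[OF l]) (use s in simp)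
  then have lim: "(\<lambda>n. (a n - a (Suc n)) / s) \<longlonglongrightarrow> 0" by simp
  have bound: "k1 (Suc n) + k2 n \<le> (a n - a (Suc n)) / s" for n
    using decay[of n] s by (simp add: field_simps)
  have bound1: "k1 (Suc n) \<le> (a n - a (Suc n)) / s" and bound2: "k2 n \<le> (a n - a (Suc n)) / s" for n
    using bound[of n] k(1)[of n] k(2)[of n] by linarith+
  have "(\<lambda>n. k1 (Suc n)) \<longlonglongrightarrow> 0"
    by (rule tendsto_sandwich[OF _ _ tendsto_const lim])
       (use bound1 k in \<open>auto intro!: always_eventually\<close>)
  then have "k1 \<longlonglongrightarrow> 0" by (rule LIMSEQ_imp_Suc)
  moreover have "k2 \<longlonglongrightarrow> 0"
    by (rule tendsto_sandwich[OF _ _ tendsto_const lim])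
       (use bound2 k in \<open>auto intro!: always_eventually\<close>)
  ultimately show ?thesis using tendsto_add by fastforce
qed

text \<open>Density of \<open>V\<close> in \<open>H\<close>: the functional given by
  \<open>h\<close> vanishes on a dense subspace, hence at \<open>h\<close> itself.\<close>

lemma to_dual_eq_0:
  assumes "dense_embedding j" "to_dual j h = 0" shows "h = 0"
proof -
  have "continuous_on (closure (range (blinfun_apply j))) (\<lambda>w. inner h w)"
    by (intro continuous_intros)
  moreover have "inner h w = 0" if "w \<in> range (blinfun_apply j)" for w
    using that to_dual_apply[of j h] assms(2) by auto
  moreover have "h \<in> closure (range (blinfun_apply j))"
    using assms(1) by (simp add: dense_embedding_def)
  ultimately have "inner h h = 0" by (rule continuous_constant_on_closure)
  then show ?thesis by simp
qed

lemma properD: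
  assumes "proper T p Q"
  shows "dense_embedding (emb Q)" "inj (blinfun_apply (emb Q))" "Lp_operator T p (evol Q)"
    "0 \<le> inner (mass Q u - mass Q v) (u - v)" "inner (mass Q u) v = inner (mass Q v) u"
  using assms unfolding proper_def dense_embedding_def by (elim conjE, simp)+

theorem theorem1:
  fixes T p s :: real
    and P :: "('v::banach, 'h::{real_inner,banach}) problem"
    and P1 :: "('v1::banach, 'h1::{real_inner,banach}) problem"
    and P2 :: "('v2::banach, 'h2::{real_inner,banach}) problem"
    and E1 :: "'h1 \<Rightarrow>\<^sub>L 'h" and R1 :: "'h \<Rightarrow>\<^sub>L 'h1"
    and E2 :: "'h2 \<Rightarrow>\<^sub>L 'h" and R2 :: "'h \<Rightarrow>\<^sub>L 'h2"
    and k1 :: "(real \<Rightarrow> 'v1) \<Rightarrow> real" and k2 :: "(real \<Rightarrow> 'v2) \<Rightarrow> real"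
    and u :: "real \<Rightarrow> 'v" and u1 u2 :: "nat \<Rightarrow> real \<Rightarrow> 'h"
  assumes "T > 0" and "p \<ge> 2"
    and "source P \<in> Lp T (conj_exponent p)"
    and "source P1 \<in> Lp T (conj_exponent p)"
    and "source P2 \<in> Lp T (conj_exponent p)"
    and "decomposition_I T p P P1 E1 R1 P2 E2 R2"
    and "decomposition_II p P P1 R1 P2 R2"
    and "decomposition_III T p P P1 E1 R1 P2 E2 R2"
    and "nonneg_functional T p k1" and "k_monotone T p k1 (evol P1)"
    and "nonneg_functional T p k2" and "k_monotone T p k2 (evol P2)"
    and "u \<in> W_space T p P" and "aeq T (full_op T p P u) (\<lambda>t. 0)"
    and "(\<lambda>t. emb P (u t)) \<in> split_dom T p P1 R1 \<inter> split_dom T p P2 R2"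
    and "s > 0"
    and "u2 0 \<in> split_dom T p P2 R2"
    and "\<And>n. u1 (Suc n) \<in> split_dom T p P1 R1 \<and> u2 (Suc n) \<in> split_dom T p P2 R2"
    and "peaceman_rachford T s (split_op T p P1 E1 R1) (split_op T p P2 E2 R2) u1 u2 \<or>
         douglas_rachford T s (split_op T p P1 E1 R1) (split_op T p P2 E2 R2) u1 u2"
  shows "(\<lambda>n. k1 (V_part T p (emb P1) (\<lambda>t. R1 (u1 n t - emb P (u t)))) +
              k2 (V_part T p (emb P2) (\<lambda>t. R2 (u2 n t - emb P (u t))))) \<longlonglongrightarrow> 0"
proof -
  let ?F1 = "split_op T p P1 E1 R1" and ?F2 = "split_op T p P2 E2 R2"
  let ?U = "\<lambda>t. emb P (u t)"
  define e1 where "e1 n t = u1 n t - ?U t" for n t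
  define e2 where "e2 n t = u2 n t - ?U t" for n t
  define d1 where "d1 n t = ?F1 (u1 n) t - ?F1 ?U t" for n t
  define d2 where "d2 n t = ?F2 (u2 n) t - ?F2 ?U t" for n t
  define \<kappa>1 where "\<kappa>1 n = k1 (V_part T p (emb P1) (\<lambda>t. R1 (e1 n t)))" for n
  define \<kappa>2 where "\<kappa>2 n = k2 (V_part T p (emb P2) (\<lambda>t. R2 (e2 n t)))" for n
  have p: "1 < p" using assms(2) by simp
  have pr: "proper T p P" "proper T p P1" "proper T p P2"
    and adj1: "\<And>u v. inner (E1 u) v = inner u (R1 v)"
    and adj2: "\<And>u v. inner (E2 u) v = inner u (R2 v)"
    using assms(6) unfolding decomposition_I_def by auto
  note P = properD(1)[OF pr(1)]
  note A1 = properD(3)[OF pr(2)] and inj1 = properD(2)[OF pr(2)]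
    and mono1 = properD(4)[OF pr(2)] and sym1 = properD(5)[OF pr(2)]
  note A2 = properD(3)[OF pr(3)] and inj2 = properD(2)[OF pr(3)]
    and mono2 = properD(4)[OF pr(3)] and sym2 = properD(5)[OF pr(3)]
  have U1: "?U \<in> split_dom T p P1 R1" and U2: "?U \<in> split_dom T p P2 R2" using assms(15) by auto
  have dom1: "u1 (Suc n) \<in> split_dom T p P1 R1" for n using assms(18) by blast
  have dom2: "u2 n \<in> split_dom T p P2 R2" for n using assms(17,18) by (cases n) auto
  note mon1 = split_op_monotone[OF assms(1) p dom1 U1 A1 inj1 mono1 sym1 adj1 assms(9,10),
      folded e1_def d1_def \<kappa>1_def]
  note mon2 = split_op_monotone[OF assms(1) p dom2 U2 A2 inj2 mono2 sym2 adj2 assms(11,12),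
      folded e2_def d2_def \<kappa>2_def]
  note dom_Lp = split_dom_subset_Lp[THEN subsetD]
  have L: "e1 (Suc n) \<in> Lp T 2" "e2 n \<in> Lp T 2" "d1 (Suc n) \<in> Lp T 2" "d2 n \<in> Lp T 2" for n
  proof -
    show "e1 (Suc n) \<in> Lp T 2" unfolding e1_def[abs_def]
      by (rule Lp_diff[OF dom_Lp[OF dom1] dom_Lp[OF U1]]) simp
    show "e2 n \<in> Lp T 2" unfolding e2_def[abs_def]
      by (rule Lp_diff[OF dom_Lp[OF dom2] dom_Lp[OF U1]]) simp
    show "d1 (Suc n) \<in> Lp T 2" unfolding d1_def[abs_def]
      by (rule Lp_diff[OF split_op_Lp[OF dom1 A1 inj1] split_op_Lp[OF U1 A1 inj1]]) simp
    show "d2 n \<in> Lp T 2" unfolding d2_def[abs_def]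
      by (rule Lp_diff[OF split_op_Lp[OF dom2 A2 inj2] split_op_Lp[OF U2 A2 inj2]]) simp
  qed
  \<comment> \<open>This is \<open>(sI + F2) u2 - (sI + F2) u\<close>, the quantity whose squared
    norm serves as energy for both schemes.\<close>
  define en where "en n t = s *\<^sub>R e2 n t + d2 n t" for n t
  have enL: "en n \<in> Lp T 2" for n
    unfolding en_def[abs_def] by (intro Lp_add Lp_scaleR L) auto
  define a where "a n = (\<integral>t. (norm (en n t))\<^sup>2 \<partial>time_measure T)" for n
  have int_en: "integrable (time_measure T) (\<lambda>t. (norm (en n t))\<^sup>2)" for n
    using Lp_D(2)[OF enL] by simp
  let ?I = "\<lambda>n t. inner (d1 (Suc n) t) (e1 (Suc n) t) + inner (d2 n t) (e2 n t)"
  have i1: "integrable (time_measure T) (\<lambda>t. inner (d1 (Suc n) t) (e1 (Suc n) t))"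
    and i2: "integrable (time_measure T) (\<lambda>t. inner (d2 n t) (e2 n t))" for n
    by (rule integrable_inner_L2[OF L(3,1)], rule integrable_inner_L2[OF L(4,2)])
  have I: "\<kappa>1 (Suc n) + \<kappa>2 n \<le> (\<integral>t. ?I n t \<partial>time_measure T)" for n
    using mon1(2)[of n] mon2(2)[of n] i1[of n] i2[of n] by (simp add: \<kappa>1_def \<kappa>2_def)
  have \<kappa>_nonneg: "0 \<le> \<kappa>1 (Suc n)" "0 \<le> \<kappa>2 n" for n
    using mon1(1) mon2(1) by (auto simp: \<kappa>1_def \<kappa>2_def)
  have I0: "0 \<le> (\<integral>t. ?I n t \<partial>time_measure T)" for n
    using I[of n] \<kappa>_nonneg[of n] by simp
  \<comment> \<open>The equation holds in the dual of \<open>V\<close>; Assumption (III) writes its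
    left side as the image of an element of \<open>H\<close>, and density of the embedding makes
    that element vanish.\<close>
  have FU: "AE t in time_measure T. ?F1 ?U t + ?F2 ?U t = 0"
  proof -
    have "aeq T ?U ?U" by (simp add: aeq_def)
    then have "aeq T (full_op T p P u) (\<lambda>t. to_dual (emb P) (?F1 ?U t + ?F2 ?U t))"
      using assms(8,13,15) unfolding decomposition_III_def by blast
    then show ?thesis
      using assms(14) unfolding aeq_def
      by eventually_elim (metis to_dual_eq_0[OF P])
  qed
  have integrate: "a (Suc n) \<le> a n - c * (\<integral>t. ?I n t \<partial>time_measure T)"
    if "AE t in time_measure T. (norm (en (Suc n) t))\<^sup>2 \<le> (norm (en n t))\<^sup>2 - c * ?I n t" for c n
  proof -
    have "a (Suc n) \<le> (\<integral>t. (norm (en n t))\<^sup>2 - c * ?I n t \<partial>time_measure T)"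
      unfolding a_def by (rule integral_mono_AE[OF int_en _ that]) (use int_en i1 i2 in auto)
    also have "\<dots> = a n - c * (\<integral>t. ?I n t \<partial>time_measure T)"
      unfolding a_def using int_en[of n] i1[of n] i2[of n]
      by (subst Bochner_Integration.integral_diff) auto
    finally show ?thesis .
  qed
  \<comment> \<open>The solution satisfies \<open>s z + k = s z - l\<close> because
    \<open>k + l = 0\<close>; subtracting this from a half step gives the same relation for the
    errors. Peaceman-Rachford uses it a second time with the two operators exchanged.\<close>
  have shift: "s *\<^sub>R (x - z) + (f - k) = s *\<^sub>R (y - z) - (g - l)"
    if "s *\<^sub>R x + f = s *\<^sub>R y - g" "k + l = 0" for x y z f g k l :: 'h
  proof -
    have l: "l = - k" using that(2) by (simp add: eq_neg_iff_add_eq_0 add.commute)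
    have "s *\<^sub>R (x - z) + (f - k) = (s *\<^sub>R x + f) - (s *\<^sub>R z + k)" by (simp add: algebra_simps)
    also have "\<dots> = s *\<^sub>R (y - z) - (g - l)" unfolding that(1) l by (simp add: algebra_simps)
    finally show ?thesis .
  qed
  have first: "s *\<^sub>R e1 (Suc n) t + d1 (Suc n) t = s *\<^sub>R e2 n t - d2 n t"
    if "s *\<^sub>R u1 (Suc n) t + ?F1 (u1 (Suc n)) t = s *\<^sub>R u2 n t - ?F2 (u2 n) t"
      "?F1 ?U t + ?F2 ?U t = 0" for n t
    unfolding e1_def e2_def d1_def d2_def by (rule shift[OF that])
  have decay: "a (Suc n) \<le> a n - 2 * s * (\<integral>t. ?I n t \<partial>time_measure T)" for n
    using assms(19)
  proof
    assume "peaceman_rachford T s ?F1 ?F2 u1 u2"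
    then have "AE t in time_measure T.
        s *\<^sub>R u1 (Suc n) t + ?F1 (u1 (Suc n)) t = s *\<^sub>R u2 n t - ?F2 (u2 n) t"
      and "AE t in time_measure T.
        s *\<^sub>R u2 (Suc n) t + ?F2 (u2 (Suc n)) t = s *\<^sub>R u1 (Suc n) t - ?F1 (u1 (Suc n)) t"
      by (auto simp: peaceman_rachford_def aeq_def)
    then have "AE t in time_measure T. (norm (en (Suc n) t))\<^sup>2 \<le> (norm (en n t))\<^sup>2 - 4 * s * ?I n t"
      using FU
    proof eventually_elim
      case (elim t)
      have "s *\<^sub>R e2 (Suc n) t + d2 (Suc n) t = s *\<^sub>R e1 (Suc n) t - d1 (Suc n) t"
        unfolding e1_def e2_def d1_def d2_def
        by (rule shift[OF elim(2)]) (use elim(3) in \<open>simp add: add.commute\<close>)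
      then show ?case
        using peaceman_rachford_energy[OF first[OF elim(1,3)]] by (simp add: en_def)
    qed
    then have "a (Suc n) \<le> a n - 4 * s * (\<integral>t. ?I n t \<partial>time_measure T)" by (rule integrate)
    \<comment> \<open>Half of the Peaceman-Rachford decay is given up to reach the constant
      \<open>2 * s\<close> shared with Douglas-Rachford.\<close>
    moreover have "0 \<le> 2 * s * (\<integral>t. ?I n t \<partial>time_measure T)" using I0[of n] assms(16) by simp
    ultimately show ?thesis by linarith
  next
    assume "douglas_rachford T s ?F1 ?F2 u1 u2"
    then have "AE t in time_measure T.
        s *\<^sub>R u1 (Suc n) t + ?F1 (u1 (Suc n)) t = s *\<^sub>R u2 n t - ?F2 (u2 n) t"
      and "AE t in time_measure T.
        s *\<^sub>R u2 (Suc n) t + ?F2 (u2 (Suc n)) t = s *\<^sub>R u1 (Suc n) t + ?F2 (u2 n) t"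
      by (auto simp: douglas_rachford_def aeq_def)
    then have "AE t in time_measure T. (norm (en (Suc n) t))\<^sup>2 \<le> (norm (en n t))\<^sup>2 - 2 * s * ?I n t"
      using FU
    proof eventually_elim
      \<comment> \<open>In the second Douglas-Rachford step \<open>F2\<close> stands on both sides,
        so its value at the solution cancels without recourse to the equation for
        \<open>u\<close>.\<close>
      case (elim t)
      have "s *\<^sub>R e2 (Suc n) t + d2 (Suc n) t = s *\<^sub>R e1 (Suc n) t + d2 n t"
        using elim(2) unfolding e1_def e2_def d2_def by (simp add: algebra_simps)
      then show ?case
        using douglas_rachford_energy[OF first[OF elim(1,3)]] by (simp add: en_def)
    qed
    then show ?thesis by (rule integrate)
  qed
  have "(\<lambda>n. \<kappa>1 n + \<kappa>2 n) \<longlonglongrightarrow> 0"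
  proof (rule energy_decay_tendsto_0)
    show "0 \<le> a n" for n unfolding a_def by simp
    show "0 < 2 * s" using assms(16) by simp
    show "0 \<le> \<kappa>1 (Suc n)" "0 \<le> \<kappa>2 n" for n by (rule \<kappa>_nonneg)+
    show "a (Suc n) \<le> a n - 2 * s * (\<kappa>1 (Suc n) + \<kappa>2 n)" for n
      using decay[of n] mult_left_mono[OF I[of n], of "2 * s"] assms(16) by linarith
  qed
  then show ?thesis unfolding \<kappa>1_def \<kappa>2_def e1_def e2_def .
qed

end
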